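(* Let $n\ge 1$ and let $B_n$ be the bouquet of $n$ loops, represented as the simple graph with a central vertex $c$ and, for each $i=1,\dots,n$, two vertices $a_i,a_i'$ with edges $ca_i$, $a_ia_i'$, $a_i'c$. Let its automorphism group be $\Gamma=E_1\times S_n[C_2]$, the group of permutations of the $2n+1$ vertices fixing $c$ and mapping each pair $\{a_i,a_i'\}$ onto some pair $\{a_j,a_j'\}$ (order $2^nn!$). For a divisor $d$ of $2n$, the number $i_d$ of unlabeled imbeddings of $B_n$ that are $d$-fold symmetric, i.e. whose map-automorphism group is cyclic of order $d$ (the group $E_1\times C_d[E_{2n/d}]$), is \[ i_d=d\sum_{k:\ d\mid k,\ k\mid 2n} f(n,k)\,\mu(k/d),\] where $f(n,k)=A(n,k)+B(n,k)$ with \[A(n,k)=\begin{cases}\dfrac{(2n/k)!\,(k/2)^{n/k}}{2n\,(n/k)!}& k\mid n,\\ 0 & k\nmid n,\end{cases}\qquad B(n,k)=\begin{cases}\dfrac1{2n}\displaystyle\sum_{m=0}^{\lfloor (n-1)/k\rfloor}\frac{(2n/k)!\,(k/2)^m}{(2n/k-2m)!\,m!}& k\text{ even},\\ 0& k\text{ odd},\end{cases}\] and $\mu$ is the Möbius function.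
   Context: A rotation at a vertex $v$ is a cyclic permutation of its neighborhood $N(v)$ (a single cycle through all of $N(v)$); a map is $M=(B_n,\rho)$ with $\rho=\{\rho_v\}$ a rotation system (so only the rotation at $c$, a cyclic ordering of the $2n$ vertices $a_i,a_i'$, is a genuine choice). The group $\Gamma$ acts on maps by $\rho\mapsto\rho'$ with $\rho'_{\gamma(v)}=\gamma\rho_v\gamma^{-1}$; the stabilizer of $M$ in $\Gamma$ is the map-automorphism group $\Gamma_M$, and the $\Gamma$-orbits of maps are the unlabeled imbeddings. *)

theory Defs
  imports Complex_Main "HOL-Algebra.Group_Action" "HOL-Algebra.Elementary_Groups"
    "HOL-Combinatorics.Orbits" "HOL-Computational_Algebra.Squarefree"
begin

datatype vertex = Center | Av nat | Av' nat

definition bouquet_verts :: "nat \<Rightarrow> vertex set" where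
  "bouquet_verts n = {Center} \<union> Av ` {1..n} \<union> Av' ` {1..n}"

definition bouquet_edges :: "nat \<Rightarrow> vertex set set" where
  "bouquet_edges n = (\<Union>i\<in>{1..n}. {{Center, Av i}, {Av i, Av' i}, {Av' i, Center}})"

definition neighborhood :: "nat \<Rightarrow> vertex \<Rightarrow> vertex set" where
  "neighborhood n v = {w. {v, w} \<in> bouquet_edges n}"

definition is_rotation :: "'a set \<Rightarrow> ('a \<Rightarrow> 'a) \<Rightarrow> bool" where
  "is_rotation N p \<longleftrightarrow> p permutes N \<and> cyclic_on p N"

text \<open>A map on the bouquet is given by its rotation system alone. Rotations are the identity off
  the neighborhood, and a rotation system takes the dummy value \<open>id\<close> off the vertex set, so that
  each map has exactly one representation.\<close>

definition bouquet_maps :: "nat \<Rightarrow> (vertex \<Rightarrow> vertex \<Rightarrow> vertex) set" where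
  "bouquet_maps n = {\<rho>. (\<forall>v\<in>bouquet_verts n. is_rotation (neighborhood n v) (\<rho> v)) \<and>
                (\<forall>v. v \<notin> bouquet_verts n \<longrightarrow> \<rho> v = id)}"

text \<open>For \<open>n = 1\<close> the graph is a triangle, which has further automorphisms moving the center; the
  group below is the one fixing the center for every \<open>n\<close>.\<close>

definition Gamma :: "nat \<Rightarrow> (vertex \<Rightarrow> vertex) monoid" where
  "Gamma n = \<lparr>carrier = {\<gamma>. \<gamma> permutes bouquet_verts n \<and> \<gamma> Center = Center \<and>
                  (\<forall>i\<in>{1..n}. \<exists>j\<in>{1..n}. \<gamma> ` {Av i, Av' i} = {Av j, Av' j})},
              monoid.mult = (\<circ>), one = id\<rparr>"

text \<open>The new rotation at \<open>w = \<gamma> v\<close> is \<open>\<gamma> \<circ> \<rho> v \<circ> \<gamma>\<inverse>\<close>. The restriction to \<^term>\<open>bouquet_maps n\<close> is what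
  the library's notion of a group action requires.\<close>

definition map_action ::
    "nat \<Rightarrow> (vertex \<Rightarrow> vertex) \<Rightarrow> (vertex \<Rightarrow> vertex \<Rightarrow> vertex) \<Rightarrow> (vertex \<Rightarrow> vertex \<Rightarrow> vertex)" where
  "map_action n \<gamma> = (\<lambda>\<rho>\<in>bouquet_maps n. \<lambda>w. \<gamma> \<circ> \<rho> (inv_into UNIV \<gamma> w) \<circ> inv_into UNIV \<gamma>)"

definition map_aut_group :: "nat \<Rightarrow> (vertex \<Rightarrow> vertex \<Rightarrow> vertex) \<Rightarrow> (vertex \<Rightarrow> vertex) monoid" where
  "map_aut_group n \<rho> = (Gamma n)\<lparr>carrier := stabilizer (Gamma n) (map_action n) \<rho>\<rparr>"

definition unlabeled_imbeddings :: "nat \<Rightarrow> (vertex \<Rightarrow> vertex \<Rightarrow> vertex) set set" where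
  "unlabeled_imbeddings n = orbits (Gamma n) (bouquet_maps n) (map_action n)"

definition fold_symmetric :: "nat \<Rightarrow> nat \<Rightarrow> (vertex \<Rightarrow> vertex \<Rightarrow> vertex) \<Rightarrow> bool" where
  "fold_symmetric n d \<rho> \<longleftrightarrow> cyclic_group (map_aut_group n \<rho>) \<and> order (map_aut_group n \<rho>) = d"

text \<open>Maps in one orbit have conjugate automorphism groups, so any representative may be used.\<close>

definition num_fold_symmetric :: "nat \<Rightarrow> nat \<Rightarrow> nat" where
  "num_fold_symmetric n d =
     card {X \<in> unlabeled_imbeddings n. \<exists>\<rho>\<in>X. fold_symmetric n d \<rho>}"

text \<open>Permutation groups are given as sets of permutations together with the set of points they act
  on: the identity group \<open>E\<close> on any set; the cyclic group \<open>C\<^sub>d\<close> on \<open>{..<d}\<close>; the product \<open>G \<times> H\<close>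
  on the disjoint union of the point sets; the composition \<open>G[H]\<close> on \<open>X \<times> Y\<close>, in which \<open>G\<close>
  permutes the copies of \<open>Y\<close> while elements of \<open>H\<close> act independently inside the copies.\<close>

definition identity_perms :: "('a \<Rightarrow> 'a) set" where
  "identity_perms = {id}"

definition cyclic_perms :: "nat \<Rightarrow> (nat \<Rightarrow> nat) set" where
  "cyclic_perms d = {\<lambda>i. if i < d then (i + r) mod d else i | r. r < d}"

definition product_perms :: "('a \<Rightarrow> 'a) set \<Rightarrow> ('b \<Rightarrow> 'b) set \<Rightarrow> ('a + 'b \<Rightarrow> 'a + 'b) set" where
  "product_perms G H = {map_sum g h | g h. g \<in> G \<and> h \<in> H}"

definition composition_perms ::
    "'a set \<Rightarrow> 'b set \<Rightarrow> ('a \<Rightarrow> 'a) set \<Rightarrow> ('b \<Rightarrow> 'b) set \<Rightarrow> ('a \<times> 'b \<Rightarrow> 'a \<times> 'b) set" where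
  "composition_perms X Y G H =
     {p. p permutes X \<times> Y \<and>
         (\<exists>g\<in>G. \<exists>h. (\<forall>x\<in>X. h x \<in> H) \<and> (\<forall>x\<in>X. \<forall>y\<in>Y. p (x, y) = (g x, h x y)))}"

definition perm_isomorphic ::
    "'a set \<Rightarrow> ('a \<Rightarrow> 'a) set \<Rightarrow> 'b set \<Rightarrow> ('b \<Rightarrow> 'b) set \<Rightarrow> bool" where
  "perm_isomorphic X G Y H \<longleftrightarrow>
     (\<exists>f. bij_betw f Y X \<and>
          G = {p. p permutes X \<and> (\<exists>h\<in>H. \<forall>y\<in>Y. p (f y) = f (h y))})"

definition E1_Cd_points :: "nat \<Rightarrow> nat \<Rightarrow> (nat + nat \<times> nat) set" where
  "E1_Cd_points d m = {..<1} <+> ({..<d} \<times> {..<m})"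

definition E1_Cd_perms :: "nat \<Rightarrow> nat \<Rightarrow> (nat + nat \<times> nat \<Rightarrow> nat + nat \<times> nat) set" where
  "E1_Cd_perms d m = product_perms identity_perms
     (composition_perms {..<d} {..<m} (cyclic_perms d) identity_perms)"

definition moebius_mu :: "nat \<Rightarrow> int" where
  "moebius_mu k = (if squarefree k then (-1) ^ card (prime_factors k) else 0)"

definition A_term :: "nat \<Rightarrow> nat \<Rightarrow> real" where
  "A_term n k =
     (if k dvd n
      then fact (2 * n div k) * (real k / 2) ^ (n div k) / (2 * real n * fact (n div k))
      else 0)"

definition B_term :: "nat \<Rightarrow> nat \<Rightarrow> real" where
  "B_term n k =
     (if even k
      then 1 / (2 * real n) *
        (\<Sum>m = 0..(n - 1) div k.
           fact (2 * n div k) * (real k / 2) ^ m / (fact (2 * n div k - 2 * m) * fact m))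
      else 0)"

definition f_term :: "nat \<Rightarrow> nat \<Rightarrow> real" where
  "f_term n k = A_term n k + B_term n k"

end

theory Submission
  imports Defs "HOL-Combinatorics.Cycles"
begin

text \<open>The rotations at the outer vertices are forced, so a map is a cyclic permutation \<open>\<sigma>\<close> of the
  \<open>2n\<close> outer vertices, \<open>\<Gamma>\<close> is the centralizer of the involution \<open>\<tau>\<close> exchanging \<open>a\<^sub>i\<close> and
  \<open>a\<^sub>i'\<close>, and the automorphism group consists of the powers of \<open>\<sigma>\<close> that commute with \<open>\<tau>\<close>. It is
  therefore always cyclic and semiregular on the outer vertices.

  For the count, the roles of \<open>\<sigma>\<close> and \<open>\<tau>\<close> are exchanged: all cycles are conjugate and all
  fixed-point-free involutions are conjugate, so instead of varying \<open>\<sigma>\<close> one may fix \<open>\<sigma>\<close> and vary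
  \<open>\<tau>\<close>. With the orbit-stabilizer theorem, \<open>2n i\<^sub>d\<close> becomes \<open>d\<close> times the number of
  fixed-point-free involutions \<open>\<tau>\<close> commuting with exactly \<open>d\<close> powers of \<open>\<sigma>\<close>. Those commuting
  with at least the subgroup of order \<open>k\<close> number \<open>2n f(n, k)\<close>, and Moebius inversion finishes the
  proof.\<close>

section \<open>Moebius inversion\<close>

text \<open>With \<tau> fixed, one would have to sort out which subgroups of \<open>Gamma n\<close>
  occur as symmetry groups. With \<sigma> fixed, there is one candidate for each divisor k of 2n:
  the powers of \<sigma>^(2n/k), a permutation with q = 2n/k cycles, all of length k. An involution
  commuting with it matches up these cycles. If m pairs of cycles are chosen, each pair can be
  matched in k ways and each of the other q - 2m cycles only by its half turn, so the count is q!
  (k/2)^m / ((q - 2m)! m!). The half turn exists only for even k. Hence the two parts of f: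
  \<open>B_term\<close> collects the m with 2m < q, and \<open>A_term\<close> is the single m = q/2,
  where no cycle is matched with itself and k may be odd. The factors come from group orders: an
  orbit of maps with d symmetries has |\<Gamma>|/d members, the centralizer of \<sigma> has 2n
  elements and that of \<tau> is \<Gamma>, so |\<Gamma>| cancels without being computed. The order d
  alone determines the permutation group because all groups of powers of a full cycle that have the
  same order are relabelings of each other.\<close>

lemma moebius_mu_prime_mult:
  assumes p: "prime p" and "\<not> p dvd k" and k: "squarefree k"
  shows "moebius_mu (p * k) = - moebius_mu k"
proof -
  have "k \<noteq> 0" using k by (intro notI) simp
  have "coprime p k" using p assms(2) by (simp add: prime_imp_coprime)
  then have sq: "squarefree (p * k)" using p k by (simp add: squarefree_mult_coprime squarefree_prime)
  have "prime_factors (p * k) = insert p (prime_factors k)"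
    using p \<open>k \<noteq> 0\<close> by (auto simp: prime_factors_product prime_factorization_prime)
  moreover have "p \<notin> prime_factors k" using assms(2) by auto
  ultimately show ?thesis using sq k by (simp add: moebius_mu_def)
qed

text \<open>Only squarefree divisors contribute. For a prime p dividing n, multiplication by p pairs
  those prime to p with those divisible by p, and paired terms have opposite signs.\<close>

lemma sum_moebius_mu:
  assumes "n > 0"
  shows "(\<Sum>k | k dvd n. moebius_mu k) = (if n = 1 then 1 else 0)"
proof (cases "n = 1")
  case True
  then show ?thesis by (simp add: moebius_mu_def)
next
  case False
  then obtain p where p: "prime p" "p dvd n" using prime_factor_nat by blast
  define D where "D = {k. k dvd n \<and> squarefree k \<and> \<not> p dvd k}"
  have fin: "finite {k. k dvd n}" using assms by (simp add: finite_divisors_nat)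
  have finD: "finite D" by (rule finite_subset[OF _ fin]) (auto simp: D_def)
  have "{k. k dvd n \<and> squarefree k} = D \<union> (\<lambda>k. p * k) ` D"
  proof (intro equalityI subsetI)
    fix k assume k: "k \<in> {k. k dvd n \<and> squarefree k}"
    show "k \<in> D \<union> (\<lambda>k. p * k) ` D"
    proof (cases "p dvd k")
      case True
      then obtain l where l: "k = p * l" by (elim dvdE)
      have "\<not> p dvd l"
      proof
        assume "p dvd l"
        then have "p ^ 2 dvd k" using l by (auto simp: power2_eq_square)
        then show False using k squarefreeD[of k p] p(1) by auto
      qed
      moreover have "squarefree l" using k l squarefree_multD(2) by auto
      moreover have "l dvd n" using k l dvd_mult_right by auto
      ultimately show ?thesis using l by (auto simp: D_def)
    qed (use k in \<open>auto simp: D_def\<close>)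
  next
    fix k assume k: "k \<in> D \<union> (\<lambda>k. p * k) ` D"
    then consider "k \<in> D" | l where "l \<in> D" "k = p * l" by blast
    then show "k \<in> {k. k dvd n \<and> squarefree k}"
    proof cases
      case 2
      then have "coprime p l" using p by (simp add: D_def prime_imp_coprime)
      then show ?thesis using 2 p
        by (auto simp: D_def intro: divides_mult squarefree_mult_coprime squarefree_prime)
    qed (simp add: D_def)
  qed
  moreover have "(\<Sum>k | k dvd n. moebius_mu k) = (\<Sum>k | k dvd n \<and> squarefree k. moebius_mu k)"
    by (rule sum.mono_neutral_right[OF fin]) (auto simp: moebius_mu_def)
  ultimately have "(\<Sum>k | k dvd n. moebius_mu k) = (\<Sum>k\<in>D \<union> (\<lambda>k. p * k) ` D. moebius_mu k)"
    by simp
  also have "\<dots> = (\<Sum>k\<in>D. moebius_mu k) + (\<Sum>k\<in>(\<lambda>k. p * k) ` D. moebius_mu k)"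
    by (rule sum.union_disjoint) (use finD in \<open>auto simp: D_def\<close>)
  also have "(\<Sum>k\<in>(\<lambda>k. p * k) ` D. moebius_mu k) = (\<Sum>k\<in>D. moebius_mu (p * k))"
    by (rule sum.reindex_cong[of "\<lambda>k. p * k"]) (use p in \<open>auto simp: inj_on_def\<close>)
  also have "\<dots> = (\<Sum>k\<in>D. - moebius_mu k)"
    by (rule sum.cong) (use p in \<open>auto simp: D_def moebius_mu_prime_mult\<close>)
  finally show ?thesis using False by (simp add: sum_negf)
qed

text \<open>Inversion over the multiples of d below N in the divisor order. After the two sums are
  swapped, \<open>M e\<close> is multiplied by the sum of \<mu>(k/d) over d | k | e, which vanishes
  unless e = d.\<close>

lemma moebius_inversion_multiples:
  fixes F M :: "nat \<Rightarrow> real"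
  assumes "N > 0" "d dvd N"
    and F: "\<And>k. k dvd N \<Longrightarrow> F k = (\<Sum>e | k dvd e \<and> e dvd N. M e)"
  shows "M d = (\<Sum>k | d dvd k \<and> k dvd N. F k * of_int (moebius_mu (k div d)))"
proof -
  have "d > 0" using assms by (auto intro: Nat.gr0I)
  have fin: "finite {e. e dvd N}" using \<open>N > 0\<close> by (simp add: finite_divisors_nat)
  then have finK: "finite {k. d dvd k \<and> k dvd N}" by (rule rev_finite_subset) auto
  have inner: "(\<Sum>k | (d dvd k \<and> k dvd N) \<and> k dvd e. real_of_int (moebius_mu (k div d)))
      = (if e = d then 1 else 0)" if e: "e dvd N" for e
  proof (cases "d dvd e")
    case True
    then obtain f where f: "e = d * f" by (elim dvdE)
    have "f > 0" using e f \<open>N > 0\<close> by (auto intro: Nat.gr0I)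
    \<comment> \<open>The substitution k = d * j turns the k between d and e = d * f into the
      divisors j of f.\<close>
    have "(\<Sum>k | (d dvd k \<and> k dvd N) \<and> k dvd e. real_of_int (moebius_mu (k div d)))
        = (\<Sum>j | j dvd f. real_of_int (moebius_mu j))"
      by (rule sum.reindex_bij_witness[of _ "\<lambda>j. d * j" "\<lambda>k. k div d"])
        (use f \<open>d > 0\<close> e in \<open>auto simp: dvd_def elim!: dvdE\<close>)
    also have "\<dots> = of_int (\<Sum>j | j dvd f. moebius_mu j)" by simp
    also have "\<dots> = (if e = d then 1 else 0)"
      using sum_moebius_mu[OF \<open>f > 0\<close>] f \<open>d > 0\<close> by auto
    finally show ?thesis .
  next
    case False
    then have "{k. (d dvd k \<and> k dvd N) \<and> k dvd e} = {}" using dvd_trans by blast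
    moreover have "e \<noteq> d" using False by auto
    ultimately show ?thesis by (simp only: sum.empty if_False)
  qed
  have "(\<Sum>k | d dvd k \<and> k dvd N. F k * of_int (moebius_mu (k div d)))
      = (\<Sum>k | d dvd k \<and> k dvd N. \<Sum>e | e dvd N \<and> k dvd e. M e * of_int (moebius_mu (k div d)))"
    by (rule sum.cong) (auto simp: F sum_distrib_right conj_commute)
  also have "\<dots> = (\<Sum>e | e dvd N. \<Sum>k | (d dvd k \<and> k dvd N) \<and> k dvd e.
      M e * of_int (moebius_mu (k div d)))"
    using sum.swap_restrict[OF finK fin, of "\<lambda>k e. M e * of_int (moebius_mu (k div d))"
        "\<lambda>k e. k dvd e"] by simp
  also have "\<dots> = (\<Sum>e | e dvd N. M e * (if e = d then 1 else 0))"
    by (rule sum.cong) (auto simp only: inner simp flip: sum_distrib_left)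
  also have "\<dots> = M d"
    using fin \<open>d dvd N\<close> by (simp add: if_distrib[of "\<lambda>x. _ * x"] sum.delta' cong: if_cong)
  finally show ?thesis by simp
qed

section \<open>Matchings invariant under a semiregular permutation\<close>

text \<open>The number of perfect matchings invariant under a permutation with \<open>q\<close> cycles, all of
  length \<open>k\<close>. A fixed cycle is either matched with itself, by the half turn, or with one of the
  remaining cycles, in \<open>k\<close> ways.\<close>

fun invariant_matchings :: "nat \<Rightarrow> nat \<Rightarrow> nat" where
  "invariant_matchings k 0 = 1"
| "invariant_matchings k (Suc 0) = (if even k then 1 else 0)"
| "invariant_matchings k (Suc (Suc q)) =
     (if even k then invariant_matchings k (Suc q) else 0) + Suc q * k * invariant_matchings k q"

text \<open>Contribution of the matchings in which exactly \<open>m\<close> pairs of cycles are matched with each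
  other.\<close>

definition matching_term :: "nat \<Rightarrow> nat \<Rightarrow> nat \<Rightarrow> real" where
  "matching_term k q m = (if 2 * m \<le> q \<and> (even k \<or> 2 * m = q)
     then fact q * (real k / 2) ^ m / (fact (q - 2 * m) * fact m) else 0)"

text \<open>With q = 2(m - 1) + s, the leading factor q + 2 of (q + 2)! splits as s + 2m. The share
  s belongs to the matchings in which a chosen cycle is one of the s self-matched ones, the share 2m
  to those in which it lies in a pair.\<close>

lemma matching_term_rec:
  "matching_term k (Suc (Suc q)) m = (if even k then matching_term k (Suc q) m else 0) +
     (if m = 0 then 0 else real (Suc q * k) * matching_term k q (m - 1))"
proof (cases m)
  case 0
  then show ?thesis by (simp add: matching_term_def)
next
  case (Suc l)
  define h :: real where "h = real k / 2"
  consider "q < 2 * l" | s where "q = 2 * l + s"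
    by (metis le_Suc_ex not_le)
  then show ?thesis
  proof cases
    case 1
    \<comment> \<open>Here 2m exceeds q + 2, so all three terms are 0 by definition.\<close>
    then show ?thesis using Suc by (simp add: matching_term_def)
  next
    case (2 s)
    define D where "D = fact (Suc q) * h ^ m / (fact s * fact m)"
    have "fact (Suc (Suc q)) * h ^ m / (fact s * fact m) = (real s + real (2 * m)) * D"
      using Suc 2 by (simp only: fact_Suc[of "Suc q"] D_def) simp
    moreover have "real (Suc q * k) * (fact q * h ^ l / (fact s * fact l)) = real (2 * m) * D"
    proof -
      have "fact m = real m * (fact l :: real)" "real m \<noteq> 0" using Suc by simp_all
      then have "D = fact (Suc q) * (h * h ^ l) / (fact s * (real m * fact l))"
        using Suc by (simp add: D_def)
      moreover have "fact (Suc q) = real (Suc q) * (fact q :: real)" by simp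
      moreover have "real (Suc q * k) = real (Suc q) * (2 * h)" by (simp only: h_def of_nat_mult)
      moreover have "real (2 * m) = 2 * real m" by simp
      moreover have "a * (2 * h) * (f * p / (g * c)) = 2 * b * (a * f * (h * p) / (g * (b * c)))"
        if "b \<noteq> 0" for a b c f g p :: real
        using that by (simp add: field_simps)
      ultimately show ?thesis using \<open>real m \<noteq> 0\<close> by (simp only: simp_thms)
    qed
    \<comment> \<open>For s = 0 the subtraction would truncate; the corresponding
      \<open>matching_term\<close> is then 0 because 2m = q + 2 > q + 1.\<close>
    moreover have "fact (Suc q) * h ^ m / (fact (s - 1) * fact m) = real s * D" if "s > 0"
      using that by (cases s) (simp_all add: D_def field_simps del: of_nat_Suc)
    ultimately have D: "fact (Suc (Suc q)) * h ^ m / (fact s * fact m) = (real s + real (2 * m)) * D"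
      "real (Suc q * k) * (fact q * h ^ l / (fact s * fact l)) = real (2 * m) * D"
      "s > 0 \<Longrightarrow> fact (Suc q) * h ^ m / (fact (s - 1) * fact m) = real s * D"
      by blast+
    have e: "Suc (Suc q) - 2 * m = s" "Suc q - 2 * m = s - 1" "q - 2 * l = s" "m - 1 = l"
      "2 * m \<le> Suc (Suc q)" "2 * l \<le> q" "2 * m = Suc (Suc q) \<longleftrightarrow> s = 0" "2 * l = q \<longleftrightarrow> s = 0"
      "2 * m \<le> Suc q \<longleftrightarrow> s > 0" "m \<noteq> 0"
      using Suc 2 by auto
    have "matching_term k (Suc (Suc q)) m = (if even k \<or> s = 0 then (real s + real (2 * m)) * D else 0)"
      by (simp only: matching_term_def e D h_def[symmetric] simp_thms)
    moreover have "real (Suc q * k) * matching_term k q (m - 1) =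
        (if even k \<or> s = 0 then real (2 * m) * D else 0)"
      by (simp only: matching_term_def e D(2)[symmetric] h_def[symmetric] simp_thms) simp
    moreover have "matching_term k (Suc q) m = real s * D" if "even k"
    proof (cases "s > 0")
      case True
      show ?thesis
        by (simp only: matching_term_def e D(3)[OF True] h_def[symmetric] simp_thms that True if_True)
    qed (simp add: matching_term_def e)
    ultimately show ?thesis using e(10) by (cases "even k") (simp_all add: distrib_right)
  qed
qed

text \<open>The recursion shifts m by one in its second summand, so the induction must compare sums
  with different upper limits. A free limit \<open>B\<close> allows this, since the terms with 2m >
  q vanish.\<close>

lemma sum_matching_term:
  assumes "q \<le> B"
  shows "(\<Sum>m\<le>B. matching_term k q m) = real (invariant_matchings k q)"
  using assms
proof (induction k q arbitrary: B rule: invariant_matchings.induct)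
  case (1 k)
  have "(\<Sum>m\<le>B. matching_term k 0 m) = (\<Sum>m\<in>{0}. matching_term k 0 m)"
    by (rule sum.mono_neutral_right) (auto simp: matching_term_def)
  then show ?case by (simp add: matching_term_def)
next
  case (2 k)
  have "(\<Sum>m\<le>B. matching_term k (Suc 0) m) = (\<Sum>m\<in>{0}. matching_term k (Suc 0) m)"
    by (rule sum.mono_neutral_right) (auto simp: matching_term_def)
  then show ?case by (simp add: matching_term_def)
next
  case (3 k q)
  then obtain C where C: "B = Suc C" "Suc q \<le> C" by (cases B) auto
  have "(\<Sum>m\<le>B. matching_term k (Suc (Suc q)) m) =
     (if even k then \<Sum>m\<le>B. matching_term k (Suc q) m else 0) +
     (\<Sum>m\<le>Suc C. if m = 0 then 0 else real (Suc q * k) * matching_term k q (m - 1))"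
    by (simp only: matching_term_rec sum.distrib C) auto
  also have "(\<Sum>m\<le>Suc C. if m = 0 then 0 else real (Suc q * k) * matching_term k q (m - 1)) =
     real (Suc q * k) * (\<Sum>m\<le>C. matching_term k q m)"
    by (simp only: sum.atMost_Suc_shift) (simp add: sum_distrib_left)
  also have "(\<Sum>m\<le>C. matching_term k q m) = real (invariant_matchings k q)"
    using 3 C by simp
  finally show ?case using 3 by simp
qed

lemma f_term_eq_invariant_matchings:
  assumes "n > 0" "k dvd 2 * n"
  shows "f_term n k = real (invariant_matchings k (2 * n div k)) / real (2 * n)"
proof -
  define q where "q = 2 * n div k"
  have q: "2 * n = k * q" using assms by (simp add: q_def)
  then have "k > 0" "q > 0" using assms by (auto intro: Nat.gr0I)
  define c where "c m = fact q * (real k / 2) ^ m / (fact (q - 2 * m) * fact m)" for m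
  have dvd: "k dvd n \<longleftrightarrow> even q"
  proof -
    have "k dvd n \<longleftrightarrow> k * 2 dvd 2 * n" by (simp add: mult.commute[of k])
    also have "\<dots> \<longleftrightarrow> even q" unfolding q using \<open>k > 0\<close> by (rule nat_mult_dvd_cancel1)
    finally show ?thesis .
  qed
  have half: "n div k = q div 2"
    using q \<open>k > 0\<close> by (metis div_mult2_eq mult.commute nonzero_mult_div_cancel_left zero_neq_numeral q_def)
  have A: "A_term n k = (if even q then c (q div 2) else 0) / real (2 * n)"
    unfolding A_term_def dvd half by (simp add: c_def q_def)
  \<comment> \<open>The n - 1 in the summation limit makes the inequality strict. It keeps m = q/2
    out of \<open>B_term\<close>, so that this case is counted only by
    \<open>A_term\<close>.\<close>
  have le: "m \<le> (n - 1) div k \<longleftrightarrow> 2 * m < q" for m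
  proof -
    have "m \<le> (n - 1) div k \<longleftrightarrow> m * k \<le> n - 1" using \<open>k > 0\<close> by (simp add: less_eq_div_iff_mult_less_eq)
    also have "\<dots> \<longleftrightarrow> m * k < n" using assms by auto
    also have "\<dots> \<longleftrightarrow> 2 * (m * k) < 2 * n" by simp
    also have "\<dots> \<longleftrightarrow> k * (2 * m) < k * q" unfolding q by (simp only: mult_ac)
    finally show ?thesis using \<open>k > 0\<close> by simp
  qed
  have B: "B_term n k = (if even k then \<Sum>m | 2 * m < q. c m else 0) / real (2 * n)"
    using le by (auto simp: B_term_def c_def q_def atLeastAtMost_def atLeast_def atMost_def)
  have "real (invariant_matchings k q) = (\<Sum>m\<le>q. matching_term k q m)"
    by (simp add: sum_matching_term)
  also have "\<dots> = (\<Sum>m | 2 * m \<le> q. matching_term k q m)"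
    by (rule sum.mono_neutral_right) (auto simp: matching_term_def)
  also have "{m. 2 * m \<le> q} = {m. 2 * m < q} \<union> {m. 2 * m = q}" by auto
  also have "(\<Sum>m\<in>\<dots>. matching_term k q m) =
      (\<Sum>m | 2 * m < q. matching_term k q m) + (\<Sum>m | 2 * m = q. matching_term k q m)"
    by (rule sum.union_disjoint) (auto intro: finite_subset[of _ "{..q}"])
  also have "(\<Sum>m | 2 * m < q. matching_term k q m) = (if even k then \<Sum>m | 2 * m < q. c m else 0)"
    by (auto simp: matching_term_def c_def)
  also have "(\<Sum>m | 2 * m = q. matching_term k q m) = (if even q then c (q div 2) else 0)"
  proof (cases "even q")
    case True
    then have "{m. 2 * m = q} = {q div 2}" by auto
    then show ?thesis using True by (simp add: matching_term_def c_def)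
  next
    case False
    then have "{m. 2 * m = q} = {}" by auto
    then show ?thesis using False by (simp only: sum.empty if_False)
  qed
  finally show ?thesis using A B by (simp add: f_term_def q_def add_divide_distrib)
qed

text \<open>For \<open>r = id\<close> these are all fixed-point-free involutions of \<open>X\<close>.\<close>

definition involutions_commuting :: "'a set \<Rightarrow> ('a \<Rightarrow> 'a) \<Rightarrow> ('a \<Rightarrow> 'a) set" where
  "involutions_commuting X r =
     {\<tau>. \<tau> permutes X \<and> (\<forall>x\<in>X. \<tau> x \<noteq> x \<and> \<tau> (\<tau> x) = x \<and> \<tau> (r x) = r (\<tau> x))}"

section \<open>Counting fixed-point-free involutions that commute with a semiregular
  permutation\<close>

lemma involutions_commuting_iff:
  "\<tau> \<in> involutions_commuting X r \<longleftrightarrow> (\<forall>x. x \<notin> X \<longrightarrow> \<tau> x = x) \<and>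
     (\<forall>x\<in>X. \<tau> x \<in> X \<and> \<tau> x \<noteq> x \<and> \<tau> (\<tau> x) = x \<and> \<tau> (r x) = r (\<tau> x))" (is "?L \<longleftrightarrow> ?R")
proof
  assume ?L
  then show ?R by (auto simp: involutions_commuting_def permutes_not_in permutes_in_image)
next
  assume R: ?R
  then have inv: "\<tau> (\<tau> x) = x" for x by (cases "x \<in> X") auto
  have "\<tau> permutes X"
    unfolding permutes_def using R inv by metis
  then show ?L using R by (auto simp: involutions_commuting_def)
qed

text \<open>All cycles of \<open>r\<close> on \<open>X\<close> have length exactly \<open>k\<close>.
  The conditions concern only points of \<open>X\<close>, so the same \<open>r\<close> serves again
  after whole orbits have been removed from \<open>X\<close>.\<close>

locale semiregular =
  fixes X :: "'a set" and r :: "'a \<Rightarrow> 'a" and k :: nat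
  assumes finite_X: "finite X" and k_pos: "k > 0" and r_in: "x \<in> X \<Longrightarrow> r x \<in> X"
    and funpow_fixed_iff: "x \<in> X \<Longrightarrow> (r ^^ i) x = x \<longleftrightarrow> k dvd i"
begin

lemma funpow_in: "x \<in> X \<Longrightarrow> (r ^^ i) x \<in> X"
  by (induction i) (auto simp: r_in)

lemma funpow_eq_iff:
  assumes "x \<in> X"
  shows "(r ^^ i) x = (r ^^ j) x \<longleftrightarrow> i mod k = j mod k"
proof (induction i j rule: linorder_wlog)
  case (le i j)
  have "(r ^^ i) x = (r ^^ j) x \<longleftrightarrow> (r ^^ (j - i)) ((r ^^ i) x) = (r ^^ i) x"
  proof -
    have "(r ^^ (j - i)) ((r ^^ i) x) = (r ^^ j) x"
      using le by (metis comp_apply funpow_add le_add_diff_inverse2)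
    then show ?thesis by auto
  qed
  also have "\<dots> \<longleftrightarrow> j mod k = i mod k"
    using le by (simp add: funpow_fixed_iff funpow_in assms mod_eq_dvd_iff_nat)
  finally show ?case by auto
next
  case (sym i j)
  then show ?case by metis
qed

definition orb :: "'a \<Rightarrow> 'a set" where
  "orb x = range (\<lambda>i. (r ^^ i) x)"

lemma self_in_orb: "x \<in> orb x"
  unfolding orb_def by (rule range_eqI[of _ _ 0]) simp

lemma orb_subset: "x \<in> X \<Longrightarrow> orb x \<subseteq> X"
  by (auto simp: orb_def funpow_in)

lemma card_orb:
  assumes "x \<in> X"
  shows "card (orb x) = k"
proof -
  have "orb x = (\<lambda>i. (r ^^ i) x) ` {..<k}"
  proof -
    have "(r ^^ i) x = (r ^^ (i mod k)) x" for i
      by (simp add: funpow_eq_iff assms)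
    then show ?thesis using k_pos by (fastforce simp: orb_def)
  qed
  moreover have "inj_on (\<lambda>i. (r ^^ i) x) {..<k}"
    by (auto simp: inj_on_def funpow_eq_iff assms)
  ultimately show ?thesis by (simp add: card_image)
qed

lemma r_in_orb: "z \<in> orb x \<Longrightarrow> r z \<in> orb x"
  by (auto simp: orb_def intro: range_eqI[of _ _ "Suc _"])

text \<open>The iterate r^(k-1) undoes r on \<open>X\<close>, so orbits can also be followed
  backwards; this makes the complement of an orbit invariant under r.\<close>

lemma r_in_orb_imp:
  assumes "z \<in> X" "r z \<in> orb x"
  shows "z \<in> orb x"
proof -
  obtain i where i: "r z = (r ^^ i) x" using assms(2) by (auto simp: orb_def)
  have "z = (r ^^ k) z" using assms(1) funpow_fixed_iff by (metis dvd_refl)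
  also have "\<dots> = (r ^^ (k - 1)) (r z)"
    using k_pos by (cases k) (simp_all del: funpow.simps add: funpow_Suc_right)
  also have "\<dots> = (r ^^ (k - 1 + i)) x" by (simp add: i funpow_add)
  finally show ?thesis by (auto simp: orb_def)
qed

lemma orb_eq:
  assumes "x \<in> X" "y \<in> orb x"
  shows "orb y = orb x"
proof -
  have sub: "orb z \<subseteq> orb x" if z: "z \<in> orb x" for x z
  proof -
    obtain i where "z = (r ^^ i) x" using z by (auto simp: orb_def)
    then have "(r ^^ j) z = (r ^^ (j + i)) x" for j by (simp add: funpow_add)
    then show ?thesis by (auto simp: orb_def)
  qed
  obtain i where i: "y = (r ^^ i) x" using assms(2) by (auto simp: orb_def)
  \<comment> \<open>These further steps complete i full turns and so lead from y back to x.\<close>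
  have "(r ^^ (k * i - i)) y = (r ^^ (k * i)) x"
    using k_pos by (simp add: i flip: comp_apply[of "r ^^ (k * i - i)"] funpow_add)
  also have "\<dots> = x" using assms(1) by (simp add: funpow_fixed_iff)
  finally have "x \<in> orb y" by (auto simp: orb_def)
  then show ?thesis using sub assms(2) by blast
qed

text \<open>The case y = x covers the removal of a single orbit.\<close>

lemma semiregular_Diff_orbs:
  "semiregular (X - orb x - orb y) r k"
proof
  show "r z \<in> X - orb x - orb y" if "z \<in> X - orb x - orb y" for z
    using that r_in r_in_orb_imp by blast
qed (use finite_X k_pos funpow_fixed_iff in auto)

lemma involution_funpow:
  assumes "\<tau> \<in> involutions_commuting X r" "x \<in> X"
  shows "\<tau> ((r ^^ i) x) = (r ^^ i) (\<tau> x)"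
proof (induction i)
  case (Suc i)
  then show ?case using assms funpow_in by (simp add: involutions_commuting_def)
qed simp

text \<open>Commuting with \<open>r\<close> determines \<open>\<tau>\<close> on both orbits from the single value \<open>\<tau> x = y\<close>.\<close>

lemma card_involutions_mapping:
  assumes x: "x \<in> X" and y: "y \<in> X" and valid: "y \<notin> orb x \<or> even k \<and> y = (r ^^ (k div 2)) x"
  shows "card {\<tau> \<in> involutions_commuting X r. \<tau> x = y} =
         card (involutions_commuting (X - orb x - orb y) r)"
proof -
  define ind where "ind a z = (SOME i. (r ^^ i) a = z)" for a z
  \<comment> \<open>The forced values: r^i x and r^i y are exchanged. If y lies in
    \<open>orb x\<close>, the first branch decides alone, and the half-turn hypothesis makes it
    agree with the second rule.\<close>
  define s where "s z = (if z \<in> orb x then (r ^^ ind x z) y else (r ^^ ind y z) x)" for z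
  have ind: "ind a ((r ^^ i) a) mod k = i mod k" if "a \<in> X" for a i
  proof -
    have "(r ^^ ind a ((r ^^ i) a)) a = (r ^^ i) a"
      unfolding ind_def by (rule someI_ex) auto
    then show ?thesis using funpow_eq_iff that by blast
  qed
  have s_x: "s ((r ^^ i) x) = (r ^^ i) y" for i
    using x y by (auto simp: s_def orb_def funpow_eq_iff ind)
  have s_y: "s ((r ^^ i) y) = (r ^^ i) x" for i
  proof (cases "y \<in> orb x")
    case True
    then have "even k" "y = (r ^^ (k div 2)) x" using valid by auto
    then have y': "(r ^^ j) y = (r ^^ (j + k div 2)) x" for j by (simp add: funpow_add)
    \<comment> \<open>Two half turns make a full turn only for even k.\<close>
    have E: "i + k div 2 + k div 2 = i + k" using \<open>even k\<close> by (auto elim!: evenE)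
    have "(r ^^ i) x = (r ^^ (i + k div 2)) y"
      unfolding y' E using x by (simp add: funpow_eq_iff)
    moreover note y'[of i]
    ultimately show ?thesis using s_x by metis
  next
    case False
    then have "(r ^^ i) y \<notin> orb x"
      using orb_eq x y by (metis orb_def rangeI self_in_orb)
    then show ?thesis using x y by (simp add: s_def funpow_eq_iff ind)
  qed
  have y_neq: "(r ^^ i) y \<noteq> (r ^^ i) x" for i
  proof
    assume eq: "(r ^^ i) y = (r ^^ i) x"
    show False
    proof (cases "y \<in> orb x")
      case True
      then have k: "even k" "y = (r ^^ (k div 2)) x" using valid by auto
      then have "(r ^^ (k div 2)) ((r ^^ i) x) = (r ^^ i) x"
        using eq by (metis add.commute comp_apply funpow_add)
      then have "k dvd k div 2" using x funpow_fixed_iff funpow_in by blast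
      then show False using k(1) k_pos by (auto elim!: evenE)
    next
      case False
      then show False using eq orb_eq x y by (metis orb_def rangeI self_in_orb)
    qed
  qed
  let ?Z = "orb x \<union> orb y" and ?X = "X - orb x - orb y"
  have Z: "z \<in> ?Z \<longleftrightarrow> (\<exists>i. z = (r ^^ i) x \<or> z = (r ^^ i) y)" for z
    by (auto simp: orb_def)
  have s_props: "s z \<in> ?Z \<and> s z \<noteq> z \<and> s (s z) = z \<and> s (r z) = r (s z)" if "z \<in> ?Z" for z
  proof -
    obtain i where "z = (r ^^ i) x \<or> z = (r ^^ i) y" using \<open>z \<in> ?Z\<close> Z by blast
    then show ?thesis
    proof
      assume z: "z = (r ^^ i) x"
      then have "r z = (r ^^ Suc i) x" "s z = (r ^^ i) y" using s_x by simp_all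
      then show ?thesis using z s_x[of "Suc i"] s_y[of i] y_neq[of i] unfolding Z by simp metis
    next
      assume z: "z = (r ^^ i) y"
      then have "r z = (r ^^ Suc i) y" "s z = (r ^^ i) x" using s_y by simp_all
      then show ?thesis using z s_y[of "Suc i"] s_x[of i] y_neq[of i] unfolding Z by simp metis
    qed
  qed
  have ZX: "?Z \<subseteq> X" using orb_subset x y by auto
  have rZ: "r z \<in> ?Z \<longleftrightarrow> z \<in> ?Z" if "z \<in> X" for z
    using that r_in_orb r_in_orb_imp by blast
  let ?T = "{\<tau> \<in> involutions_commuting X r. \<tau> x = y}"
  \<comment> \<open>The bijection forgets \<tau> on the two orbits, where it is forced to be
    \<open>s\<close>; its inverse puts \<open>s\<close> back.\<close>
  let ?f = "\<lambda>\<tau> z. if z \<in> ?X then \<tau> z else z" and ?g = "\<lambda>\<tau> z. if z \<in> ?Z then s z else \<tau> z"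
  have on_Z: "\<tau> z = s z" if "\<tau> \<in> ?T" "z \<in> ?Z" for \<tau> z
  proof -
    have \<tau>: "\<tau> \<in> involutions_commuting X r" "\<tau> x = y" "\<tau> y = x"
      using that x by (auto simp: involutions_commuting_def)
    then have "\<tau> ((r ^^ i) x) = (r ^^ i) y" "\<tau> ((r ^^ i) y) = (r ^^ i) x" for i
      using involution_funpow x y by metis+
    then show ?thesis using \<open>z \<in> ?Z\<close> s_x s_y Z by metis
  qed
  have "bij_betw ?f ?T (involutions_commuting ?X r)"
  proof (rule bij_betw_byWitness[where f' = ?g])
    show "\<forall>\<tau>\<in>?T. ?g (?f \<tau>) = \<tau>"
    proof
      fix \<tau> assume \<tau>: "\<tau> \<in> ?T"
      show "?g (?f \<tau>) = \<tau>"
        using on_Z[OF \<tau>] \<tau> by (auto simp: fun_eq_iff involutions_commuting_iff)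
    qed
    show "\<forall>\<tau>\<in>involutions_commuting ?X r. ?f (?g \<tau>) = \<tau>"
      by (auto simp: fun_eq_iff involutions_commuting_iff)
    show "?f ` ?T \<subseteq> involutions_commuting ?X r"
    proof (intro image_subsetI)
      fix \<tau> assume \<tau>: "\<tau> \<in> ?T"
      have "\<tau> z \<in> ?X" if "z \<in> ?X" for z
      proof -
        have "\<tau> z \<in> X" "\<tau> (\<tau> z) = z" using that \<tau> by (auto simp: involutions_commuting_iff)
        then show ?thesis using on_Z[OF \<tau>, of "\<tau> z"] s_props[of "\<tau> z"] that by auto
      qed
      moreover have "r z \<in> ?X" if "z \<in> ?X" for z
        using that rZ[of z] r_in by auto
      moreover have "\<tau> z \<noteq> z \<and> \<tau> (\<tau> z) = z \<and> \<tau> (r z) = r (\<tau> z)" if "z \<in> ?X" for z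
        using \<tau> that unfolding involutions_commuting_iff by blast
      ultimately show "?f \<tau> \<in> involutions_commuting ?X r"
        unfolding involutions_commuting_iff by (simp del: Diff_iff)
    qed
    show "?g ` involutions_commuting ?X r \<subseteq> ?T"
    proof (intro image_subsetI CollectI conjI)
      fix \<tau> assume \<tau>: "\<tau> \<in> involutions_commuting ?X r"
      have "?g \<tau> z \<in> X \<and> ?g \<tau> z \<noteq> z \<and> ?g \<tau> (?g \<tau> z) = z \<and> ?g \<tau> (r z) = r (?g \<tau> z)" if "z \<in> X" for z
      proof (cases "z \<in> ?Z")
        case True
        then have "r z \<in> ?Z" using rZ that by blast
        then show ?thesis using s_props[OF True] True ZX by (simp only: if_True) blast
      next
        case False
        then have "r z \<notin> ?Z" using rZ that by blast
        moreover have "\<tau> z \<in> ?X \<and> \<tau> z \<noteq> z \<and> \<tau> (\<tau> z) = z \<and> \<tau> (r z) = r (\<tau> z)"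
          using \<tau> that False unfolding involutions_commuting_iff by blast
        moreover from this have "\<tau> z \<notin> ?Z" by blast
        ultimately show ?thesis using False by (simp only: if_False) blast
      qed
      moreover have "?g \<tau> z = z" if "z \<notin> X" for z
        using that ZX \<tau> unfolding involutions_commuting_iff by auto
      ultimately show "?g \<tau> \<in> involutions_commuting X r"
        unfolding involutions_commuting_iff by blast
      show "?g \<tau> x = y" using s_x[of 0] self_in_orb by simp
    qed
  qed
  then show ?thesis by (rule bij_betw_same_card)
qed

text \<open>If \<tau> x = r^i x, then applying \<tau> twice gives k | 2i, while \<tau> x \<noteq> x
  means that k does not divide i. Together these force k to be even and i to be k/2 modulo
  k.\<close>

lemma involution_mapping_valid:
  assumes "\<tau> \<in> involutions_commuting X r" "x \<in> X" "\<tau> x \<in> orb x"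
  shows "even k \<and> \<tau> x = (r ^^ (k div 2)) x"
proof -
  obtain i where i: "\<tau> x = (r ^^ i) x" using assms(3) by (auto simp: orb_def)
  have "x = \<tau> (\<tau> x)" using assms by (simp add: involutions_commuting_iff)
  also have "\<dots> = (r ^^ (i + i)) x"
    using assms by (simp add: i involution_funpow funpow_add)
  finally have "k dvd i + i" using assms(2) funpow_fixed_iff by metis
  moreover have "\<not> k dvd i"
    using assms funpow_fixed_iff i by (auto simp: involutions_commuting_iff)
  ultimately have "even k \<and> i mod k = (k div 2) mod k"
  proof -
    assume k: "k dvd i + i" "\<not> k dvd i"
    have "even k"
    proof (rule ccontr)
      assume "odd k"
      then have "coprime k 2" by simp
      then show False using k by (simp add: mult_2[symmetric] coprime_dvd_mult_right_iff)
    qed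
    then obtain l where l: "k = 2 * l" by (elim evenE)
    then have "l dvd i" using k(1) by (simp add: mult_2[symmetric])
    then obtain j where j: "i = l * j" by (elim dvdE)
    then have "odd j" using k(2) l by (auto elim!: evenE)
    then obtain j' where "j = 2 * j' + 1" by (elim oddE)
    then have "i = l + k * j'" using j l by (simp add: algebra_simps)
    then show ?thesis using \<open>even k\<close> l by simp
  qed
  then show ?thesis using assms(2) i by (simp add: funpow_eq_iff)
qed

lemma finite_involutions: "finite (involutions_commuting X r)"
  by (rule finite_subset[OF _ finite_permutations[OF finite_X]]) (auto simp: involutions_commuting_def)

text \<open>The involutions are sorted by the partner y of x. Inside \<open>orb x\<close> only the
  half turn is possible; outside it every y is.\<close>

lemma card_involutions_rec:
  assumes x: "x \<in> X"
  shows "card (involutions_commuting X r) =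
    (if even k then card (involutions_commuting (X - orb x) r) else 0) +
    (\<Sum>y\<in>X - orb x. card (involutions_commuting (X - orb x - orb y) r))"
proof -
  let ?T = "\<lambda>y. {\<tau> \<in> involutions_commuting X r. \<tau> x = y}"
  have "involutions_commuting X r = (\<Union>y\<in>X. ?T y)"
    using x by (auto simp: involutions_commuting_iff)
  then have "card (involutions_commuting X r) = card (\<Union>y\<in>X. ?T y)" by simp
  also have "\<dots> = (\<Sum>y\<in>X. card (?T y))"
    by (rule card_UN_disjoint) (use finite_X finite_involutions in auto)
  also have "\<dots> = (\<Sum>y\<in>orb x. card (?T y)) + (\<Sum>y\<in>X - orb x. card (?T y))"
    using sum.subset_diff[OF orb_subset[OF x] finite_X] by (simp add: add.commute)
  also have "(\<Sum>y\<in>orb x. card (?T y)) = (if even k then card (involutions_commuting (X - orb x) r) else 0)"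
  proof (cases "even k")
    case True
    let ?y = "(r ^^ (k div 2)) x"
    have y: "?y \<in> orb x" by (auto simp: orb_def)
    have "(\<Sum>y\<in>orb x. card (?T y)) = (\<Sum>y\<in>{?y}. card (?T y))"
    proof (rule sum.mono_neutral_right)
      show "\<forall>y\<in>orb x - {?y}. card (?T y) = 0"
      proof
        fix y assume "y \<in> orb x - {?y}"
        then have "?T y = {}" using involution_mapping_valid[OF _ x] by auto
        then show "card (?T y) = 0" by (simp only: card.empty)
      qed
    qed (use y finite_subset[OF orb_subset[OF x] finite_X] in auto)
    also have "\<dots> = card (involutions_commuting (X - orb x - orb ?y) r)"
      using card_involutions_mapping[OF x funpow_in[OF x]] True by simp
    also have "orb ?y = orb x" using orb_eq x y by blast
    finally show ?thesis using True by (simp add: Diff_insert Diff_idemp)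
  next
    case False
    have "card (?T y) = 0" if "y \<in> orb x" for y
    proof -
      have "?T y = {}" using involution_mapping_valid[OF _ x] that False by auto
      then show ?thesis by (simp only: card.empty)
    qed
    then show ?thesis using False by simp
  qed
  also have "(\<Sum>y\<in>X - orb x. card (?T y)) =
      (\<Sum>y\<in>X - orb x. card (involutions_commuting (X - orb x - orb y) r))"
    by (rule sum.cong[OF refl]) (use card_involutions_mapping[OF x] in auto)
  finally show ?thesis .
qed

end

text \<open>In the recursive step the partner of x outside its orbit is one of k(q + 1) points, each
  leaving q orbits; this is the coefficient in \<open>invariant_matchings\<close>.\<close>

lemma card_involutions_commuting:
  assumes "semiregular X r k" "card X = k * q"
  shows "card (involutions_commuting X r) = invariant_matchings k q"
  using assms
proof (induction k q arbitrary: X rule: invariant_matchings.induct)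
  case (1 k)
  then have "X = {}" by (simp add: semiregular.finite_X)
  then have "involutions_commuting X r = {id}" by (auto simp: involutions_commuting_def)
  then show ?case by simp
next
  case (2 k)
  interpret semiregular X r k by fact
  obtain x where x: "x \<in> X" using 2(2) k_pos by (cases "X = {}") auto
  have "X = orb x"
    using card_subset_eq[OF finite_X orb_subset[OF x]] 2(2) card_orb[OF x] by simp
  then have E: "X - orb x = {}" by blast
  moreover have "involutions_commuting {} r = {id}" by (auto simp: involutions_commuting_def)
  ultimately show ?case using card_involutions_rec[OF x] unfolding E by simp
next
  case (3 k q)
  interpret semiregular X r k by fact
  obtain x where x: "x \<in> X" using 3(4) k_pos by (cases "X = {}") auto
  have card: "card (X - orb x) = k * Suc q"
    using 3(4) card_orb[OF x] finite_subset[OF orb_subset[OF x] finite_X]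
    by (simp add: card_Diff_subset orb_subset x)
  have 1: "card (involutions_commuting (X - orb x) r) = invariant_matchings k (Suc q)" if "even k"
    using 3(1)[OF that _ card] semiregular_Diff_orbs[of x x] by (simp add: Diff_idemp)
  have 2: "card (involutions_commuting (X - orb x - orb y) r) = invariant_matchings k q"
    if y: "y \<in> X - orb x" for y
  proof (rule 3(2)[OF semiregular_Diff_orbs])
    have sub: "orb y \<subseteq> X - orb x"
    proof
      fix z assume z: "z \<in> orb y"
      then have "z \<in> X" using y orb_subset by blast
      moreover have "z \<notin> orb x"
        using z y orb_eq[OF x, of z] orb_eq[of y z] self_in_orb[of y] by auto
      ultimately show "z \<in> X - orb x" by blast
    qed
    have fin: "finite (orb y)"
      using finite_subset[OF sub] finite_X by blast
    have "card (X - orb x - orb y) = k * Suc q - k"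
      using card_Diff_subset[OF fin sub] card card_orb y by auto
    then show "card (X - orb x - orb y) = k * q" by simp
  qed
  have "(\<Sum>y\<in>X - orb x. card (involutions_commuting (X - orb x - orb y) r)) =
      k * Suc q * invariant_matchings k q"
    using 2 card by (simp only: sum.cong[OF refl 2] sum_constant) simp
  then show ?case using card_involutions_rec[OF x] 1 by (simp add: mult.commute)
qed

section \<open>Centralizers and conjugacy of cycles and involutions\<close>

definition centralizer :: "'a set \<Rightarrow> ('a \<Rightarrow> 'a) \<Rightarrow> ('a \<Rightarrow> 'a) set" where
  "centralizer N \<omega> = {\<gamma>. \<gamma> permutes N \<and> \<gamma> \<circ> \<omega> = \<omega> \<circ> \<gamma>}"

text \<open>The orbit of each point is all of \<open>N\<close>, so the first return takes
  \<open>card N\<close> steps and later returns occur exactly at the multiples.\<close>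

lemma semiregular_rotation:
  assumes "is_rotation N \<sigma>"
  shows "semiregular N \<sigma> (card N)"
proof
  have cyc: "cyclic_on \<sigma> N" and perm: "\<sigma> permutes N"
    using assms by (auto simp: is_rotation_def)
  show "finite N" using cyc by (rule finite_cyclic_on)
  then show "card N > 0" using cyc by (auto simp: cyclic_on_def card_gt_0_iff)
  show "\<sigma> x \<in> N" if "x \<in> N" for x using that perm by (simp add: permutes_in_image)
  show "(\<sigma> ^^ i) x = x \<longleftrightarrow> card N dvd i" if "x \<in> N" for x i
  proof -
    let ?p = "funpow_dist1 \<sigma> x x"
    have N: "Orbits.orbit \<sigma> x = N" using orbit_cyclic_eq3[OF cyc that] .
    then have self: "x \<in> Orbits.orbit \<sigma> x" using that by simp
    have inj: "inj_on (\<lambda>n. (\<sigma> ^^ n) x) {0..<?p}"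
      by (rule inj_on_funpow_dist1[OF self])
    have "N = (\<lambda>n. (\<sigma> ^^ n) x) ` {0..<?p}"
      using orbit_conv_funpow_dist1[OF self] N by simp
    then have p: "card N = ?p" using card_image[OF inj] by simp
    have "(\<sigma> ^^ card N) x = x" unfolding p by (rule funpow_dist1_prop[OF self])
    then have "(\<sigma> ^^ (i mod card N)) x = (\<sigma> ^^ i) x" by (rule funpow_mod_eq)
    moreover have "(\<sigma> ^^ (i mod card N)) x = (\<sigma> ^^ 0) x \<longleftrightarrow> i mod card N = 0"
      by (rule inj_on_eq_iff[OF inj]) (auto simp flip: p simp: \<open>card N > 0\<close>)
    ultimately show ?thesis by (simp add: dvd_eq_mod_eq_0)
  qed
qed

lemma permutes_funpow: "\<sigma> permutes N \<Longrightarrow> (\<sigma> ^^ i) permutes N"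
  by (induction i) (auto simp: permutes_compose permutes_id[unfolded id_def] id_def)

locale rotation =
  fixes N :: "'a set" and \<sigma> :: "'a \<Rightarrow> 'a"
  assumes rotation: "is_rotation N \<sigma>"
begin

sublocale semiregular N \<sigma> "card N"
  by (rule semiregular_rotation[OF rotation])

lemma permutes: "\<sigma> permutes N"
  using rotation by (simp add: is_rotation_def)

lemma ex_point: obtains x where "x \<in> N"
  using k_pos by fastforce

lemma exists_funpow:
  assumes "x \<in> N" "y \<in> N"
  obtains i where "i < card N" "y = (\<sigma> ^^ i) x"
proof -
  have "N = orb x"
    using card_subset_eq[OF finite_X orb_subset card_orb] assms by metis
  then obtain i where "y = (\<sigma> ^^ i) x" using assms by (auto simp: orb_def)
  then have "y = (\<sigma> ^^ (i mod card N)) x" using assms funpow_eq_iff by simp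
  then show ?thesis using k_pos that mod_less_divisor by blast
qed

lemma funpow_perm_eq_iff: "\<sigma> ^^ i = \<sigma> ^^ j \<longleftrightarrow> i mod card N = j mod card N"
proof
  assume "\<sigma> ^^ i = \<sigma> ^^ j"
  then show "i mod card N = j mod card N" using ex_point funpow_eq_iff by metis
next
  assume "i mod card N = j mod card N"
  then have "(\<sigma> ^^ i) x = (\<sigma> ^^ j) x" for x
    using funpow_eq_iff[of x] permutes_not_in[OF permutes_funpow[OF permutes]]
    by (cases "x \<in> N") auto
  then show "\<sigma> ^^ i = \<sigma> ^^ j" by blast
qed

lemma funpow_in_centralizer: "\<sigma> ^^ i \<in> centralizer N \<sigma>"
  unfolding centralizer_def using permutes_funpow[OF permutes]
  by (simp add: funpow_swap1 fun_eq_iff)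

text \<open>A permutation commuting with \<sigma> is determined by its value at a single point,
  since the powers of \<sigma> reach every other point; and some power of \<sigma> takes that same
  value.\<close>

lemma centralizer_eq: "centralizer N \<sigma> = (\<lambda>i. \<sigma> ^^ i) ` {..<card N}"
proof (intro equalityI subsetI)
  fix \<gamma> assume \<gamma>: "\<gamma> \<in> centralizer N \<sigma>"
  obtain x where x: "x \<in> N" by (rule ex_point)
  have perm: "\<gamma> permutes N" and comm: "\<gamma> (\<sigma> z) = \<sigma> (\<gamma> z)" for z
    using \<gamma> by (auto simp: centralizer_def fun_eq_iff)
  obtain i where i: "i < card N" "\<gamma> x = (\<sigma> ^^ i) x"
    using exists_funpow x perm permutes_in_image by metis
  have comm': "\<gamma> ((\<sigma> ^^ j) z) = (\<sigma> ^^ j) (\<gamma> z)" for j z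
    by (induction j) (simp_all add: comm)
  have "\<gamma> z = (\<sigma> ^^ i) z" for z
  proof (cases "z \<in> N")
    case True
    then obtain j where "z = (\<sigma> ^^ j) x" using exists_funpow x by metis
    then show ?thesis using i(2) comm' by (metis add.commute comp_apply funpow_add)
  next
    case False
    then show ?thesis using perm permutes_funpow[OF permutes] by (metis permutes_not_in)
  qed
  then show "\<gamma> \<in> (\<lambda>i. \<sigma> ^^ i) ` {..<card N}" using i by blast
qed (auto simp: funpow_in_centralizer)

lemma card_centralizer: "card (centralizer N \<sigma>) = card N"
  unfolding centralizer_eq by (subst card_image) (auto simp: inj_on_def funpow_perm_eq_iff)

lemma semiregular_funpow:
  assumes "q * k = card N"
  shows "semiregular N (\<sigma> ^^ q) k"
proof
  show "k > 0" using assms k_pos by (auto intro: Nat.gr0I)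
  have "q > 0" using assms k_pos by (auto intro: Nat.gr0I)
  then show "((\<sigma> ^^ q) ^^ i) x = x \<longleftrightarrow> k dvd i" if "x \<in> N" for x i
    using funpow_fixed_iff[OF that] by (simp add: funpow_mult flip: assms)
qed (auto simp: finite_X funpow_in)

text \<open>The exponents j for which \<sigma>^j commutes with \<tau> are closed under addition and
  subtraction and contain \<open>card N\<close>. They are therefore the multiples of the least
  positive one, g, and g divides \<open>card N\<close>.\<close>

lemma common_centralizer:
  assumes "\<tau> permutes N"
  obtains g e where "g * e = card N" "card (centralizer N \<sigma> \<inter> centralizer N \<tau>) = e"
    "centralizer N \<sigma> \<inter> centralizer N \<tau> = (\<lambda>i. \<sigma> ^^ (g * i)) ` {..<e}"
    "\<And>j. \<sigma> ^^ j \<in> centralizer N \<tau> \<longleftrightarrow> g dvd j"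
proof -
  define J where "J = {j. \<sigma> ^^ j \<in> centralizer N \<tau>}"
  have J: "j \<in> J \<longleftrightarrow> (\<forall>x. (\<sigma> ^^ j) (\<tau> x) = \<tau> ((\<sigma> ^^ j) x))" for j
    using permutes_funpow[OF permutes] by (simp add: J_def centralizer_def fun_eq_iff)
  have J_add: "i + j \<in> J" if "i \<in> J" "j \<in> J" for i j
    using that by (simp add: J funpow_add)
  have J_diff: "i \<in> J" if "i + j \<in> J" "j \<in> J" for i j
    unfolding J
  proof
    fix x
    \<comment> \<open>Writing x as an image under \<sigma>^j replaces the inverse power that
      subtracting exponents would call for.\<close>
    obtain y where y: "x = (\<sigma> ^^ j) y"
      using permutes_surj[OF permutes_funpow[OF permutes]] by (metis surjD)
    have "(\<sigma> ^^ i) (\<tau> ((\<sigma> ^^ j) y)) = (\<sigma> ^^ (i + j)) (\<tau> y)"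
      using that(2) by (simp add: J funpow_add)
    then show "(\<sigma> ^^ i) (\<tau> x) = \<tau> ((\<sigma> ^^ i) x)"
      using that(1) by (simp add: J y funpow_add)
  qed
  have "\<sigma> ^^ card N = \<sigma> ^^ 0" unfolding funpow_perm_eq_iff by simp
  then have J_L: "card N \<in> J" by (simp add: J)
  define g where "g = (LEAST g. g > 0 \<and> g \<in> J)"
  have g: "g > 0" "g \<in> J"
    using LeastI[of "\<lambda>g. g > 0 \<and> g \<in> J" "card N"] k_pos J_L by (auto simp: g_def)
  have mult: "g * i \<in> J" for i
    by (induction i) (auto simp: J_add g(2), simp add: J)
  have J_iff: "j \<in> J \<longleftrightarrow> g dvd j" for j
  proof
    assume "j \<in> J"
    then have "j mod g \<in> J"
      using J_diff[of "j mod g" "g * (j div g)"] mult by simp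
    moreover have "j mod g < g" using g by simp
    ultimately have "j mod g = 0"
      using not_less_Least[of "j mod g" "\<lambda>g. g > 0 \<and> g \<in> J"] by (auto simp: g_def)
    then show "g dvd j" by auto
  qed (auto simp: mult elim!: dvdE)
  then obtain e where e: "card N = g * e" using J_L by (auto elim: dvdE)
  have eq: "centralizer N \<sigma> \<inter> centralizer N \<tau> = (\<lambda>i. \<sigma> ^^ (g * i)) ` {..<e}"
  proof (intro equalityI subsetI)
    fix \<gamma> assume "\<gamma> \<in> centralizer N \<sigma> \<inter> centralizer N \<tau>"
    then obtain j where j: "\<gamma> = \<sigma> ^^ j" "j < card N" "j \<in> J"
      by (auto simp: centralizer_eq J_def)
    then obtain i where "j = g * i" using J_iff by (auto elim: dvdE)
    then show "\<gamma> \<in> (\<lambda>i. \<sigma> ^^ (g * i)) ` {..<e}" using j e by auto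
  next
    fix \<gamma> assume "\<gamma> \<in> (\<lambda>i. \<sigma> ^^ (g * i)) ` {..<e}"
    then show "\<gamma> \<in> centralizer N \<sigma> \<inter> centralizer N \<tau>"
      using funpow_in_centralizer mult by (auto simp: J_def)
  qed
  have "inj_on (\<lambda>i. \<sigma> ^^ (g * i)) {..<e}"
    using g by (auto simp: inj_on_def funpow_perm_eq_iff e)
  then have "card (centralizer N \<sigma> \<inter> centralizer N \<tau>) = e"
    unfolding eq by (simp add: card_image)
  then show ?thesis using that[of g e] e eq J_iff by (simp add: J_def)
qed

lemma card_common_centralizer_dvd:
  assumes "\<tau> permutes N"
  shows "card (centralizer N \<sigma> \<inter> centralizer N \<tau>) dvd card N"
  using common_centralizer[OF assms] by (metis dvd_triv_right)

text \<open>In a cyclic group a divisor of the order corresponds to the unique subgroup of that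
  order; here \<sigma>^q generates the one of order k. In numbers, g e = q k, so k | e exactly when
  g | q.\<close>

lemma dvd_card_common_centralizer_iff:
  assumes "\<tau> permutes N" "q * k = card N"
  shows "k dvd card (centralizer N \<sigma> \<inter> centralizer N \<tau>) \<longleftrightarrow> \<sigma> ^^ q \<in> centralizer N \<tau>"
proof -
  obtain g e where ge: "g * e = card N" "card (centralizer N \<sigma> \<inter> centralizer N \<tau>) = e"
    "\<And>j. \<sigma> ^^ j \<in> centralizer N \<tau> \<longleftrightarrow> g dvd j"
    using common_centralizer[OF assms(1)] by metis
  have pos: "q > 0" "k > 0" "g > 0" "e > 0"
    using ge(1) assms(2) k_pos by (auto intro: Nat.gr0I)
  have "k dvd e \<longleftrightarrow> g * k dvd g * e" using pos by simp
  also have "\<dots> \<longleftrightarrow> g * k dvd q * k" using ge(1) assms(2) by simp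
  also have "\<dots> \<longleftrightarrow> g dvd q" using pos by simp
  finally show ?thesis using ge by simp
qed

end

section \<open>Conjugation and conjugacy classes\<close>

definition perm_conj :: "('a \<Rightarrow> 'a) \<Rightarrow> ('a \<Rightarrow> 'a) \<Rightarrow> 'a \<Rightarrow> 'a" where
  "perm_conj \<pi> \<omega> = \<pi> \<circ> \<omega> \<circ> inv_into UNIV \<pi>"

lemma perm_conj_eq_iff:
  assumes "bij \<pi>"
  shows "perm_conj \<pi> \<omega> = \<omega>' \<longleftrightarrow> (\<forall>x. \<pi> (\<omega> x) = \<omega>' (\<pi> x))"
  unfolding perm_conj_def fun_eq_iff comp_apply
  using assms by (metis bij_inv_eq_iff)

lemma perm_conj_apply: "bij \<pi> \<Longrightarrow> perm_conj \<pi> \<omega> (\<pi> x) = \<pi> (\<omega> x)"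
  by (simp add: perm_conj_def bij_is_inj)

lemma perm_conj_inv:
  assumes "bij \<pi>"
  shows "perm_conj \<pi> (perm_conj (inv_into UNIV \<pi>) \<omega>) = \<omega>"
    "perm_conj (inv_into UNIV \<pi>) (perm_conj \<pi> \<omega>) = \<omega>"
  using assms by (simp_all add: perm_conj_def fun_eq_iff inv_inv_eq bij_is_inj bij_is_surj surj_f_inv_f)

lemma perm_conj_comp:
  assumes "bij \<pi>" "bij \<rho>"
  shows "perm_conj (\<pi> \<circ> \<rho>) \<omega> = perm_conj \<pi> (perm_conj \<rho> \<omega>)"
  using assms by (simp add: perm_conj_def o_inv_distrib comp_assoc)

lemma is_rotation_perm_conj:
  assumes "\<pi> permutes A" "is_rotation M \<omega>"
  shows "is_rotation (\<pi> ` M) (perm_conj \<pi> \<omega>)"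
proof -
  have bij: "bij \<pi>" using assms(1) by (rule permutes_bij)
  have perm: "\<omega> permutes M" and cyc: "cyclic_on \<omega> M" using assms(2) by (auto simp: is_rotation_def)
  have "perm_conj \<pi> \<omega> permutes \<pi> ` M"
  proof (rule bij_imp_permutes)
    have "bij (perm_conj \<pi> \<omega>)"
      unfolding perm_conj_def using bij permutes_bij[OF perm] by (simp add: bij_comp bij_imp_bij_inv)
    moreover have "perm_conj \<pi> \<omega> ` \<pi> ` M = \<pi> ` M"
      using permutes_image[OF perm] by (simp add: image_image perm_conj_apply[OF bij]) (metis image_image)
    ultimately show "bij_betw (perm_conj \<pi> \<omega>) (\<pi> ` M) (\<pi> ` M)"
      by (metis bij_betw_def bij_is_inj inj_on_subset subset_UNIV)
    show "perm_conj \<pi> \<omega> x = x" if "x \<notin> \<pi> ` M" for x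
    proof -
      obtain y where y: "x = \<pi> y" using bij by (metis bij_pointE)
      then have "y \<notin> M" using that by blast
      then show ?thesis using perm by (simp add: y perm_conj_apply[OF bij] permutes_not_in)
    qed
  qed
  moreover have "cyclic_on (perm_conj \<pi> \<omega>) (\<pi> ` M)"
    by (rule cyclic_on_image[OF cyc]) (rule perm_conj_apply[OF bij])
  ultimately show ?thesis by (simp add: is_rotation_def)
qed

lemma centralizer_perm_conj:
  assumes "\<pi> permutes N"
  shows "centralizer N (perm_conj \<pi> \<omega>) = perm_conj \<pi> ` centralizer N \<omega>"
proof -
  have bij: "bij \<pi>" using assms by (rule permutes_bij)
  have in_iff: "perm_conj \<pi> \<gamma> \<in> centralizer N (perm_conj \<pi> \<omega>)" if "\<gamma> \<in> centralizer N \<omega>"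
    "\<pi> permutes N" for \<pi> \<gamma> \<omega>
  proof -
    have "perm_conj \<pi> \<gamma> permutes N"
      using that unfolding perm_conj_def centralizer_def by (simp add: permutes_compose permutes_inv)
    moreover have "perm_conj \<pi> \<gamma> \<circ> perm_conj \<pi> \<omega> = perm_conj \<pi> \<omega> \<circ> perm_conj \<pi> \<gamma>"
      using that permutes_bij[OF that(2)]
      by (auto simp: perm_conj_def centralizer_def fun_eq_iff bij_is_inj)
    ultimately show ?thesis by (simp add: centralizer_def)
  qed
  show ?thesis
  proof (intro equalityI subsetI)
    fix \<gamma> assume "\<gamma> \<in> centralizer N (perm_conj \<pi> \<omega>)"
    then have "perm_conj (inv_into UNIV \<pi>) \<gamma> \<in> centralizer N \<omega>"
      using in_iff[of \<gamma> "perm_conj \<pi> \<omega>" "inv_into UNIV \<pi>"] assms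
      by (simp add: perm_conj_inv bij permutes_inv)
    then show "\<gamma> \<in> perm_conj \<pi> ` centralizer N \<omega>"
      using perm_conj_inv(1)[OF bij] by (metis image_eqI)
  qed (use in_iff assms in auto)
qed

lemma card_common_centralizer_conj:
  assumes "\<pi> permutes N"
  shows "card (centralizer N (perm_conj \<pi> \<sigma>) \<inter> centralizer N (perm_conj \<pi> \<tau>)) =
         card (centralizer N \<sigma> \<inter> centralizer N \<tau>)"
proof -
  have inj: "inj (perm_conj \<pi>)"
    by (rule inj_on_inverseI[of _ "perm_conj (inv_into UNIV \<pi>)"])
      (rule perm_conj_inv(2)[OF permutes_bij[OF assms]])
  show ?thesis
    unfolding centralizer_perm_conj[OF assms] image_Int[OF inj, symmetric]
    by (rule card_image) (rule inj_on_subset[OF inj subset_UNIV])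
qed

text \<open>The permutations conjugating \<open>\<omega>\<^sub>0\<close> into a given member of its
  conjugacy class form a coset of its centralizer, so every member is reached equally often,
  whatever \<open>P\<close> selects.\<close>

lemma card_conjugators:
  assumes "finite N" and \<Omega>: "\<Omega> = (\<lambda>\<pi>. perm_conj \<pi> \<omega>\<^sub>0) ` {\<pi>. \<pi> permutes N}"
  shows "card {\<pi>. \<pi> permutes N \<and> P (perm_conj \<pi> \<omega>\<^sub>0)} =
         card (centralizer N \<omega>\<^sub>0) * card {\<omega> \<in> \<Omega>. P \<omega>}"
proof -
  have fin: "finite {\<pi>. \<pi> permutes N}" using assms(1) by (rule finite_permutations)
  then have fin\<Omega>: "finite {\<omega> \<in> \<Omega>. P \<omega>}" by (simp add: \<Omega>)
  let ?F = "\<lambda>\<omega>. {\<pi>. \<pi> permutes N \<and> perm_conj \<pi> \<omega>\<^sub>0 = \<omega>}"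
  have fiber: "card (?F \<omega>) = card (centralizer N \<omega>\<^sub>0)" if \<omega>: "\<omega> \<in> \<Omega>" for \<omega>
  proof -
    obtain \<pi>\<^sub>1 where \<pi>\<^sub>1: "\<pi>\<^sub>1 permutes N" "perm_conj \<pi>\<^sub>1 \<omega>\<^sub>0 = \<omega>" using \<omega> \<Omega> by auto
    have bij: "bij \<pi>\<^sub>1" using \<pi>\<^sub>1 permutes_bij by blast
    let ?i = "inv_into UNIV \<pi>\<^sub>1"
    have inv: "?i (\<pi>\<^sub>1 x) = x" "\<pi>\<^sub>1 (?i x) = x" for x
      using bij by (simp_all add: bij_is_inj bij_is_surj surj_f_inv_f)
    have i\<omega>: "?i (\<omega> x) = \<omega>\<^sub>0 (?i x)" for x
      using \<pi>\<^sub>1(2) inv by (auto simp: perm_conj_def)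
    have "bij_betw (\<lambda>\<gamma>. \<pi>\<^sub>1 \<circ> \<gamma>) (centralizer N \<omega>\<^sub>0) (?F \<omega>)"
    proof (rule bij_betw_byWitness[where f' = "\<lambda>\<pi>. ?i \<circ> \<pi>"])
      show "(\<lambda>\<gamma>. \<pi>\<^sub>1 \<circ> \<gamma>) ` centralizer N \<omega>\<^sub>0 \<subseteq> ?F \<omega>"
      proof (intro image_subsetI CollectI conjI)
        fix \<gamma> assume \<gamma>: "\<gamma> \<in> centralizer N \<omega>\<^sub>0"
        show p: "\<pi>\<^sub>1 \<circ> \<gamma> permutes N" using \<gamma> \<pi>\<^sub>1 by (simp add: centralizer_def permutes_compose)
        show "perm_conj (\<pi>\<^sub>1 \<circ> \<gamma>) \<omega>\<^sub>0 = \<omega>"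
          unfolding perm_conj_eq_iff[OF permutes_bij[OF p]]
          using \<gamma> perm_conj_apply[OF bij, of \<omega>\<^sub>0] unfolding \<pi>\<^sub>1(2)
          by (auto simp: centralizer_def fun_eq_iff)
      qed
      show "(\<lambda>\<pi>. ?i \<circ> \<pi>) ` ?F \<omega> \<subseteq> centralizer N \<omega>\<^sub>0"
      proof (intro image_subsetI)
        fix \<pi> assume \<pi>: "\<pi> \<in> ?F \<omega>"
        then have "bij \<pi>" "perm_conj \<pi> \<omega>\<^sub>0 = \<omega>" by (auto dest: permutes_bij)
        then have "\<pi> (\<omega>\<^sub>0 x) = \<omega> (\<pi> x)" for x
          using perm_conj_eq_iff by metis
        then show "?i \<circ> \<pi> \<in> centralizer N \<omega>\<^sub>0"
          using \<pi> permutes_inv[OF \<pi>\<^sub>1(1)] by (simp add: centralizer_def permutes_compose fun_eq_iff i\<omega>)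
      qed
      show "\<forall>\<gamma>\<in>centralizer N \<omega>\<^sub>0. ?i \<circ> (\<pi>\<^sub>1 \<circ> \<gamma>) = \<gamma>" by (simp add: inv fun_eq_iff)
      show "\<forall>\<pi>\<in>?F \<omega>. \<pi>\<^sub>1 \<circ> (?i \<circ> \<pi>) = \<pi>"
        unfolding comp_assoc[symmetric] by (simp add: inv comp_def)
    qed
    then show ?thesis by (rule bij_betw_same_card[symmetric])
  qed
  have "{\<pi>. \<pi> permutes N \<and> P (perm_conj \<pi> \<omega>\<^sub>0)} = (\<Union>\<omega>\<in>{\<omega> \<in> \<Omega>. P \<omega>}. ?F \<omega>)"
    using \<Omega> by auto
  also have "card \<dots> = (\<Sum>\<omega>\<in>{\<omega> \<in> \<Omega>. P \<omega>}. card (?F \<omega>))"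
    by (rule card_UN_disjoint[OF fin\<Omega>]) (use fin in auto)
  also have "\<dots> = card (centralizer N \<omega>\<^sub>0) * card {\<omega> \<in> \<Omega>. P \<omega>}"
    using fiber by simp
  finally show ?thesis .
qed

text \<open>The conjugator sends \<sigma>^i x to \<sigma>'^i x. It is well defined because both
  iterates depend on i only modulo \<open>card N\<close>.\<close>

lemma rotations_conjugate:
  assumes "is_rotation N \<sigma>" "is_rotation N \<sigma>'"
  obtains \<pi> where "\<pi> permutes N" "perm_conj \<pi> \<sigma> = \<sigma>'"
proof -
  interpret s: rotation N \<sigma> by unfold_locales fact
  interpret t: rotation N \<sigma>' by unfold_locales fact
  obtain x where x: "x \<in> N" by (rule s.ex_point)
  define ind where "ind z = (SOME i. (\<sigma> ^^ i) x = z)" for z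
  define \<pi> where "\<pi> z = (if z \<in> N then (\<sigma>' ^^ ind z) x else z)" for z
  have ind: "(\<sigma> ^^ ind z) x = z" if "z \<in> N" for z
    unfolding ind_def by (rule someI_ex) (use s.exists_funpow[OF x that] in metis)
  have \<pi>: "\<pi> ((\<sigma> ^^ i) x) = (\<sigma>' ^^ i) x" for i
  proof -
    have "(\<sigma> ^^ ind ((\<sigma> ^^ i) x)) x = (\<sigma> ^^ i) x" using ind s.funpow_in x by blast
    then show ?thesis using x by (simp add: \<pi>_def s.funpow_in s.funpow_eq_iff t.funpow_eq_iff)
  qed
  have "\<pi> ` N = N"
  proof (intro equalityI subsetI)
    fix z assume "z \<in> \<pi> ` N"
    then show "z \<in> N" using x by (auto simp: \<pi>_def t.funpow_in)
  next
    fix z assume "z \<in> N"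
    then obtain i where "z = (\<sigma>' ^^ i) x" using t.exists_funpow x by metis
    then show "z \<in> \<pi> ` N" using \<pi> s.funpow_in x by (metis imageI)
  qed
  then have perm: "\<pi> permutes N"
    by (intro bij_imp_permutes) (auto simp: bij_betw_def \<pi>_def s.finite_X intro: eq_card_imp_inj_on)
  have "\<pi> (\<sigma> z) = \<sigma>' (\<pi> z)" for z
  proof (cases "z \<in> N")
    case True
    then obtain i where "z = (\<sigma> ^^ i) x" using s.exists_funpow x by metis
    then show ?thesis using \<pi>[of i] \<pi>[of "Suc i"] by simp
  next
    case False
    then show ?thesis using s.permutes t.permutes by (simp add: \<pi>_def permutes_not_in)
  qed
  then show ?thesis using that perm perm_conj_eq_iff permutes_bij by metis
qed

text \<open>One matched pair is removed on each side and the bijection of the rest is extended. Two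
  sets \<open>N\<close> and \<open>M\<close> are allowed because the remainders differ even if the
  original sets are equal.\<close>

lemma fixed_point_free_involutions_isomorphic:
  assumes "finite N" "finite M" "card N = card M"
    and "\<And>x. x \<in> N \<Longrightarrow> \<tau> x \<in> N \<and> \<tau> x \<noteq> x \<and> \<tau> (\<tau> x) = x"
    and "\<And>x. x \<in> M \<Longrightarrow> \<tau>' x \<in> M \<and> \<tau>' x \<noteq> x \<and> \<tau>' (\<tau>' x) = x"
  shows "\<exists>f. bij_betw f N M \<and> (\<forall>x\<in>N. f (\<tau> x) = \<tau>' (f x))"
  using assms
proof (induction "card N" arbitrary: N M rule: less_induct)
  case less
  show ?case
  proof (cases "N = {}")
    case True
    then show ?thesis using less.prems by (auto simp: bij_betw_def)
  next
    case False
    then obtain x y where xy: "x \<in> N" "y \<in> M" using less.prems by fastforce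
    let ?N = "N - {x, \<tau> x}" and ?M = "M - {y, \<tau>' y}"
    have x': "\<tau> x \<in> N" "\<tau> x \<noteq> x" "\<tau> (\<tau> x) = x" and y': "\<tau>' y \<in> M" "\<tau>' y \<noteq> y" "\<tau>' (\<tau>' y) = y"
      using less.prems xy by auto
    have cards: "card ?N = card N - 2" "card ?M = card M - 2"
      using x' y' xy by (simp_all add: card_Diff_subset)
    have "card N > 0" using xy less.prems by (auto simp: card_gt_0_iff)
    have "\<exists>f. bij_betw f ?N ?M \<and> (\<forall>x\<in>?N. f (\<tau> x) = \<tau>' (f x))"
    proof (rule less.hyps)
      show "card ?N < card N" using cards \<open>card N > 0\<close> by simp
      show "card ?N = card ?M" using cards less.prems by simp
      show "\<tau> z \<in> ?N \<and> \<tau> z \<noteq> z \<and> \<tau> (\<tau> z) = z" if "z \<in> ?N" for z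
        using that less.prems(4)[of z] x' by auto
      show "\<tau>' z \<in> ?M \<and> \<tau>' z \<noteq> z \<and> \<tau>' (\<tau>' z) = z" if "z \<in> ?M" for z
        using that less.prems(5)[of z] y' by auto
    qed (use less.prems in auto)
    then obtain f where f: "bij_betw f ?N ?M" "\<forall>x\<in>?N. f (\<tau> x) = \<tau>' (f x)" by blast
    let ?f = "f(x := y, \<tau> x := \<tau>' y)"
    have "bij_betw ?f ?N ?M"
      using f(1) by (rule bij_betw_cong[THEN iffD1, rotated]) auto
    moreover have "bij_betw ?f {x, \<tau> x} {y, \<tau>' y}"
      using x' y' by (auto simp: bij_betw_def inj_on_def)
    ultimately have "bij_betw ?f (?N \<union> {x, \<tau> x}) (?M \<union> {y, \<tau>' y})"
      by (rule bij_betw_combine) auto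
    moreover have "?N \<union> {x, \<tau> x} = N" "?M \<union> {y, \<tau>' y} = M" using xy x' y' by auto
    ultimately have "bij_betw ?f N M" by simp
    moreover have "?f (\<tau> z) = \<tau>' (?f z)" if "z \<in> N" for z
    proof (cases "z \<in> {x, \<tau> x}")
      case True
      then show ?thesis using x' y' by auto
    next
      case False
      then have "\<tau> z \<notin> {x, \<tau> x}" using that less.prems(4)[of z] x' by auto
      then show ?thesis using False f(2) that by auto
    qed
    ultimately show ?thesis by blast
  qed
qed

lemma involutions_conjugate:
  assumes "finite N" "\<tau> \<in> involutions_commuting N id" "\<tau>' \<in> involutions_commuting N id"
  obtains \<pi> where "\<pi> permutes N" "perm_conj \<pi> \<tau> = \<tau>'"
proof -
  obtain f where f: "bij_betw f N N" "\<forall>x\<in>N. f (\<tau> x) = \<tau>' (f x)"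
    using fixed_point_free_involutions_isomorphic[OF assms(1) assms(1) refl, of \<tau> \<tau>'] assms
    by (auto simp: involutions_commuting_iff)
  define \<pi> where "\<pi> z = (if z \<in> N then f z else z)" for z
  have perm: "\<pi> permutes N"
  proof (rule bij_imp_permutes)
    show "bij_betw \<pi> N N" using f(1) by (rule bij_betw_cong[THEN iffD1, rotated]) (simp add: \<pi>_def)
  qed (simp add: \<pi>_def)
  have "\<pi> (\<tau> z) = \<tau>' (\<pi> z)" for z
    using f assms(2,3) by (cases "z \<in> N") (auto simp: \<pi>_def involutions_commuting_iff)
  then show ?thesis using that perm perm_conj_eq_iff permutes_bij by metis
qed

lemma involutions_perm_conj:
  assumes "\<pi> permutes N" "\<tau> \<in> involutions_commuting N id"
  shows "perm_conj \<pi> \<tau> \<in> involutions_commuting N id"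
proof -
  have bij: "bij \<pi>" using assms(1) by (rule permutes_bij)
  have "perm_conj \<pi> \<tau> permutes N"
    using assms unfolding perm_conj_def involutions_commuting_def
    by (simp add: permutes_compose permutes_inv)
  moreover have "perm_conj \<pi> \<tau> x \<noteq> x \<and> perm_conj \<pi> \<tau> (perm_conj \<pi> \<tau> x) = x" if x: "x \<in> N" for x
  proof -
    obtain y where "x = \<pi> y" "y \<in> N" using x permutes_image[OF assms(1)] by blast
    then show ?thesis using assms bij
      by (auto simp: perm_conj_apply involutions_commuting_def dest: bij_is_inj injD)
  qed
  ultimately show ?thesis by (simp add: involutions_commuting_def)
qed

text \<open>Both sides count the permutations \<open>\<pi>\<close> of \<open>N\<close> for which \<open>\<pi> \<sigma> \<pi>\<inverse>\<close> and \<open>\<tau>\<close> have exactly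
  \<open>d\<close> common symmetries.\<close>

lemma card_rotations_exchange:
  assumes "is_rotation N \<sigma>" "\<tau> \<in> involutions_commuting N id"
  shows "card N * card {\<sigma>'. is_rotation N \<sigma>' \<and> card (centralizer N \<sigma>' \<inter> centralizer N \<tau>) = d} =
    card (centralizer N \<tau>) *
      card {\<tau>' \<in> involutions_commuting N id. card (centralizer N \<sigma> \<inter> centralizer N \<tau>') = d}"
proof -
  interpret rotation N \<sigma> by unfold_locales fact
  have rot: "Collect (is_rotation N) = (\<lambda>\<pi>. perm_conj \<pi> \<sigma>) ` {\<pi>. \<pi> permutes N}"
  proof (intro equalityI subsetI)
    fix \<sigma>' assume "\<sigma>' \<in> Collect (is_rotation N)"
    then show "\<sigma>' \<in> (\<lambda>\<pi>. perm_conj \<pi> \<sigma>) ` {\<pi>. \<pi> permutes N}"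
      using rotations_conjugate[OF assms(1)] by (metis image_eqI mem_Collect_eq)
  next
    fix \<sigma>' assume "\<sigma>' \<in> (\<lambda>\<pi>. perm_conj \<pi> \<sigma>) ` {\<pi>. \<pi> permutes N}"
    then show "\<sigma>' \<in> Collect (is_rotation N)"
      using is_rotation_perm_conj[OF _ assms(1)] permutes_image by fastforce
  qed
  have inv: "involutions_commuting N id = (\<lambda>\<pi>. perm_conj \<pi> \<tau>) ` {\<pi>. \<pi> permutes N}"
  proof (intro equalityI subsetI)
    fix \<tau>' assume "\<tau>' \<in> involutions_commuting N id"
    then show "\<tau>' \<in> (\<lambda>\<pi>. perm_conj \<pi> \<tau>) ` {\<pi>. \<pi> permutes N}"
      using involutions_conjugate[OF finite_X assms(2)] by (metis image_eqI mem_Collect_eq)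
  qed (use involutions_perm_conj assms(2) in auto)
  let ?A = "{\<pi>. \<pi> permutes N \<and> card (centralizer N (perm_conj \<pi> \<sigma>) \<inter> centralizer N \<tau>) = d}"
  let ?B = "{\<pi>. \<pi> permutes N \<and> card (centralizer N \<sigma> \<inter> centralizer N (perm_conj \<pi> \<tau>)) = d}"
  have flip: "card (centralizer N \<sigma> \<inter> centralizer N (perm_conj (inv_into UNIV \<pi>) \<tau>)) =
      card (centralizer N (perm_conj \<pi> \<sigma>) \<inter> centralizer N \<tau>)" if "\<pi> permutes N" for \<pi>
    using card_common_centralizer_conj[OF that, of \<sigma> "perm_conj (inv_into UNIV \<pi>) \<tau>"]
    by (simp add: perm_conj_inv permutes_bij[OF that])
  \<comment> \<open>Conjugating both permutations by the inverse of \<pi> moves \<pi> from \<sigma>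
    to \<tau> without changing the number of common symmetries.\<close>
  have "bij_betw (inv_into UNIV) ?A ?B"
  proof (rule bij_betw_byWitness[where f' = "inv_into UNIV"])
    show "inv_into UNIV ` ?A \<subseteq> ?B" by (auto simp: flip permutes_inv)
    show "inv_into UNIV ` ?B \<subseteq> ?A"
    proof (intro image_subsetI)
      fix \<pi> assume "\<pi> \<in> ?B"
      moreover from this have "inv_into UNIV (inv_into UNIV \<pi>) = \<pi>"
        by (auto dest: permutes_bij simp: inv_inv_eq)
      ultimately show "inv_into UNIV \<pi> \<in> ?A"
        using flip[of "inv_into UNIV \<pi>"] by (simp add: permutes_inv)
    qed
  qed (auto dest: permutes_bij simp: inv_inv_eq)
  then have "card ?A = card ?B" by (rule bij_betw_same_card)
  then show ?thesis
    using card_conjugators[OF finite_X rot, of "\<lambda>\<sigma>'. card (centralizer N \<sigma>' \<inter> centralizer N \<tau>) = d"]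
      card_conjugators[OF finite_X inv, of "\<lambda>\<tau>'. card (centralizer N \<sigma> \<inter> centralizer N \<tau>') = d"]
    by (simp add: card_centralizer)
qed

text \<open>The left side counts the involutions commuting with \<sigma>^q, whose cycles have length
  k. These are the ones whose number e of common symmetries with \<sigma> is a multiple of k, and
  the right side sorts them by e.\<close>

lemma card_involutions_eq_sum:
  assumes "is_rotation N \<sigma>" "q * k = card N"
  shows "invariant_matchings k q = (\<Sum>e | k dvd e \<and> e dvd card N.
    card {\<tau> \<in> involutions_commuting N id. card (centralizer N \<sigma> \<inter> centralizer N \<tau>) = e})"
proof -
  interpret rotation N \<sigma> by unfold_locales fact
  let ?E = "{e. k dvd e \<and> e dvd card N}"
  let ?T = "\<lambda>e. {\<tau> \<in> involutions_commuting N id. card (centralizer N \<sigma> \<inter> centralizer N \<tau>) = e}"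
  \<comment> \<open>The identity has cycles of length 1; this instance supplies the finiteness of
    the set of all fixed-point-free involutions.\<close>
  interpret I: semiregular N id 1
    by unfold_locales (auto simp: finite_X)
  have fin: "finite (involutions_commuting N id)" by (rule I.finite_involutions)
  have "finite ?E" using k_pos by (auto intro: finite_subset[OF _ finite_divisors_nat])
  have "involutions_commuting N (\<sigma> ^^ q) =
      {\<tau> \<in> involutions_commuting N id. \<sigma> ^^ q \<in> centralizer N \<tau>}" (is "?L = ?R")
  proof -
    have "(\<forall>x\<in>N. \<tau> ((\<sigma> ^^ q) x) = (\<sigma> ^^ q) (\<tau> x)) \<longleftrightarrow> \<sigma> ^^ q \<in> centralizer N \<tau>"
      if "\<tau> permutes N" for \<tau>
      unfolding centralizer_def using permutes_funpow[OF permutes, of q] that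
      by (auto simp: fun_eq_iff) (metis permutes_not_in)
    then show ?thesis unfolding involutions_commuting_def by auto
  qed
  also have "\<dots> = (\<Union>e\<in>?E. ?T e)"
    using dvd_card_common_centralizer_iff[OF _ assms(2)] card_common_centralizer_dvd
    by (auto simp: involutions_commuting_def)
  finally have "card (involutions_commuting N (\<sigma> ^^ q)) = card (\<Union>e\<in>?E. ?T e)" by simp
  also have "\<dots> = (\<Sum>e\<in>?E. card (?T e))"
    by (rule card_UN_disjoint) (use \<open>finite ?E\<close> fin in auto)
  also have "card (involutions_commuting N (\<sigma> ^^ q)) = invariant_matchings k q"
    by (rule card_involutions_commuting[OF semiregular_funpow[OF assms(2)]])
      (use assms(2) in \<open>simp add: mult.commute\<close>)
  finally show ?thesis .
qed

section \<open>The permutation group \<open>E\<^sub>1 \<times> C\<^sub>d[E\<^sub>m]\<close>\<close>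

text \<open>Starting from a point a, the point with exponent g x + y, y < g, gets the coordinates
  (x, y). Then \<sigma>^g raises x by one modulo e and keeps y, so the copies permuted by the cyclic
  group are the runs of g consecutive points. The point c plays the part of
  \<open>E\<^sub>1\<close>.\<close>

lemma perm_isomorphic_rotation_powers:
  assumes "is_rotation N \<sigma>" "g * e = card N" "c \<notin> N"
  shows "perm_isomorphic (insert c N) ((\<lambda>i. \<sigma> ^^ (g * i)) ` {..<e}) (E1_Cd_points e g) (E1_Cd_perms e g)"
proof -
  interpret rotation N \<sigma> by unfold_locales fact
  obtain a where a: "a \<in> N" by (rule ex_point)
  have "g > 0" "e > 0" using assms(2) k_pos by (auto intro: Nat.gr0I)
  define f where "f = case_sum (\<lambda>_::nat. c) (\<lambda>(x, y). (\<sigma> ^^ (g * x + y)) a)"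
  have f_simps [simp]: "f (Inl i) = c" "f (Inr (x, y)) = (\<sigma> ^^ (g * x + y)) a" for i x y
    by (simp_all add: f_def)
  let ?Y = "E1_Cd_points e g"
  have f_image: "f ` ?Y = insert c N"
  proof (intro equalityI subsetI)
    fix z assume "z \<in> f ` ?Y"
    then show "z \<in> insert c N" using a by (auto simp: E1_Cd_points_def funpow_in)
  next
    fix z assume "z \<in> insert c N"
    then consider "z = c" | "z \<in> N" by blast
    then show "z \<in> f ` ?Y"
    proof cases
      case 1
      then have "z = f (Inl 0)" "Inl 0 \<in> ?Y" by (auto simp: E1_Cd_points_def)
      then show ?thesis by blast
    next
      case 2
      then obtain i where i: "i < g * e" "z = (\<sigma> ^^ i) a"
        using exists_funpow[OF a] assms(2) by metis
      then have "z = f (Inr (i div g, i mod g))" by simp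
      moreover have "Inr (i div g, i mod g) \<in> ?Y"
        using i \<open>g > 0\<close> by (auto simp: E1_Cd_points_def less_mult_imp_div_less mult.commute)
      ultimately show ?thesis by blast
    qed
  qed
  have "card ?Y = card (insert c N)"
    using assms(2,3) finite_X by (simp add: E1_Cd_points_def card_Plus mult.commute)
  moreover have "finite ?Y" by (simp add: E1_Cd_points_def)
  ultimately have bij: "bij_betw f ?Y (insert c N)"
    unfolding bij_betw_def using f_image by (simp add: eq_card_imp_inj_on)
  have perm: "(\<sigma> ^^ i) permutes N" for i by (rule permutes_funpow[OF permutes])
  have shift: "(\<sigma> ^^ (g * r)) (f y) = f (h y)"
    if y: "y \<in> ?Y" and h: "\<And>i. i < 1 \<Longrightarrow> h (Inl i) = Inl i"
      "\<And>x y. x < e \<Longrightarrow> y < g \<Longrightarrow> h (Inr (x, y)) = Inr ((x + r) mod e, y)" for r h y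
  proof -
    consider i where "y = Inl i" "i < 1" | u v where "y = Inr (u, v)" "u < e" "v < g"
      using y by (auto simp: E1_Cd_points_def)
    then show ?thesis
    proof cases
      case 1
      then show ?thesis using h permutes_not_in[OF perm assms(3)] by simp
    next
      case 2
      \<comment> \<open>Reducing the first coordinate modulo e changes the exponent by a multiple of
        g e, the length of the cycle.\<close>
      have "(g * ((u + r) mod e) + v) mod (g * e) = (g * (u + r) + v) mod (g * e)"
        by (simp only: mult_mod_right mod_add_left_eq)
      also have "g * (u + r) + v = g * r + (g * u + v)" by (simp add: algebra_simps)
      finally have "(g * ((u + r) mod e) + v) mod (g * e) = (g * r + (g * u + v)) mod (g * e)" .
      then have "(\<sigma> ^^ (g * ((u + r) mod e) + v)) a = (\<sigma> ^^ (g * r + (g * u + v))) a"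
        unfolding funpow_eq_iff[OF a] assms(2) .
      then show ?thesis using 2 h by (simp add: funpow_add)
    qed
  qed
  have "(\<lambda>i. \<sigma> ^^ (g * i)) ` {..<e} =
    {p. p permutes insert c N \<and> (\<exists>h\<in>E1_Cd_perms e g. \<forall>y\<in>?Y. p (f y) = f (h y))}" (is "?L = ?R")
  proof (intro equalityI subsetI)
    fix p assume "p \<in> ?L"
    then obtain r where r: "r < e" "p = \<sigma> ^^ (g * r)" by auto
    let ?D = "{..<e} \<times> {..<g}"
    define c' where "c' = (\<lambda>i. if i < e then (i + r) mod e else i)"
    define q where "q = (\<lambda>(x, y). if x < e \<and> y < g then ((x + r) mod e, y) else (x, y))"
    have "q permutes ?D"
    proof (rule bij_imp_permutes)
      have "inj_on q ?D"
      proof (rule inj_onI)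
        fix z w assume "z \<in> ?D" "w \<in> ?D" "q z = q w"
        then obtain x y x' where z: "z = (x, y)" "w = (x', y)" "x < e" "x' < e"
          and eq: "(x + r) mod e = (x' + r) mod e"
          by (auto simp: q_def)
        have "(u + r) mod e = (if u + r < e then u + r else u + r - e)" if "u < e" for u
          using that r(1) by (simp add: mod_if)
        then show "z = w" using z eq by (auto split: if_splits)
      qed
      moreover have "q ` ?D \<subseteq> ?D" using \<open>e > 0\<close> by (auto simp: q_def)
      ultimately show "bij_betw q ?D ?D"
        by (simp add: bij_betw_def endo_inj_surj)
    qed (auto simp: q_def split: if_splits)
    moreover have "c' \<in> cyclic_perms e" using r by (auto simp: cyclic_perms_def c'_def)
    ultimately have "q \<in> composition_perms {..<e} {..<g} (cyclic_perms e) identity_perms"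
      unfolding composition_perms_def
      by (auto simp: identity_perms_def q_def c'_def intro!: bexI[of _ c'] exI[of _ "\<lambda>_. id"])
    then have "map_sum id q \<in> E1_Cd_perms e g"
      by (auto simp: E1_Cd_perms_def product_perms_def identity_perms_def)
    moreover have "\<forall>y\<in>?Y. p (f y) = f (map_sum id q y)"
      unfolding r(2) by (intro ballI shift) (auto simp: q_def)
    moreover have "p permutes insert c N"
      unfolding r(2) by (rule permutes_subset[OF perm]) auto
    ultimately show "p \<in> ?R" by blast
  next
    fix p assume "p \<in> ?R"
    then obtain h where p: "p permutes insert c N" and h: "h \<in> E1_Cd_perms e g"
      and ph: "\<And>y. y \<in> ?Y \<Longrightarrow> p (f y) = f (h y)" by blast
    \<comment> \<open>The inner group is trivial, so a member of the model is one common shift r of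
      the copies.\<close>
    obtain r where r: "r < e" and hx: "\<And>x y. x < e \<Longrightarrow> y < g \<Longrightarrow> h (Inr (x, y)) = Inr ((x + r) mod e, y)"
      and h0: "\<And>i. h (Inl i) = Inl i"
      using h by (auto simp: E1_Cd_perms_def product_perms_def identity_perms_def
          composition_perms_def cyclic_perms_def)
    have "p z = (\<sigma> ^^ (g * r)) z" for z
    proof (cases "z \<in> insert c N")
      case True
      then obtain y where "y \<in> ?Y" "z = f y" using f_image by blast
      then show ?thesis using ph shift[of y h r] h0 hx by simp
    next
      case False
      then show ?thesis using permutes_not_in[OF p False] permutes_not_in[OF perm] by auto
    qed
    then show "p \<in> ?L" using r by blast
  qed
  then show ?thesis unfolding perm_isomorphic_def using bij by blast
qed

text \<open>Following one labeling backwards and the other forwards gives a permutation of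
  \<open>X\<close> that conjugates \<open>G\<close> into \<open>G'\<close>. Used in both directions,
  this shows that isomorphism with the model determines the order of the group.\<close>

lemma card_perm_isomorphic_le:
  assumes "perm_isomorphic X G Y H" "perm_isomorphic X G' Y H"
    and "finite X" "\<And>h y. h \<in> H \<Longrightarrow> y \<in> Y \<Longrightarrow> h y \<in> Y"
  shows "card G \<le> card G'"
proof -
  obtain f where f: "bij_betw f Y X"
    and G: "G = {p. p permutes X \<and> (\<exists>h\<in>H. \<forall>y\<in>Y. p (f y) = f (h y))}"
    using assms(1) by (auto simp: perm_isomorphic_def)
  obtain f' where f': "bij_betw f' Y X"
    and G': "G' = {p. p permutes X \<and> (\<exists>h\<in>H. \<forall>y\<in>Y. p (f' y) = f' (h y))}"
    using assms(2) by (auto simp: perm_isomorphic_def)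
  define \<pi> where "\<pi> x = (if x \<in> X then f' (inv_into Y f x) else x)" for x
  have "bij_betw (f' \<circ> inv_into Y f) X X"
    using bij_betw_trans[OF bij_betw_inv_into[OF f] f'] .
  then have "bij_betw \<pi> X X"
    by (rule bij_betw_cong[THEN iffD1, rotated]) (simp add: \<pi>_def)
  then have perm: "\<pi> permutes X" by (rule bij_imp_permutes) (simp add: \<pi>_def)
  have bij: "bij \<pi>" using perm by (rule permutes_bij)
  have \<pi>: "\<pi> (f y) = f' y" if "y \<in> Y" for y
    using f that by (auto simp: \<pi>_def bij_betw_def)
  have "perm_conj \<pi> ` G \<subseteq> G'"
  proof (intro image_subsetI)
    fix p assume "p \<in> G"
    then obtain h where p: "p permutes X" "h \<in> H" "\<And>y. y \<in> Y \<Longrightarrow> p (f y) = f (h y)"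
      unfolding G by blast
    have "perm_conj \<pi> p permutes X"
      unfolding perm_conj_def using p perm by (simp add: permutes_compose permutes_inv)
    moreover have "perm_conj \<pi> p (f' y) = f' (h y)" if "y \<in> Y" for y
      using perm_conj_apply[OF bij, of p "f y"] p assms(4) \<pi> that by simp
    ultimately show "perm_conj \<pi> p \<in> G'" unfolding G' using p(2) by blast
  qed
  moreover have "inj_on (perm_conj \<pi>) G"
    by (rule inj_on_inverseI[of _ "perm_conj (inv_into UNIV \<pi>)"]) (rule perm_conj_inv(2)[OF bij])
  moreover have "finite G'"
    unfolding G' by (rule finite_subset[OF _ finite_permutations[OF assms(3)]]) auto
  ultimately show ?thesis by (metis card_image card_mono)
qed

lemma E1_Cd_perms_closed:
  assumes "h \<in> E1_Cd_perms d m" "y \<in> E1_Cd_points d m"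
  shows "h y \<in> E1_Cd_points d m"
proof -
  obtain q where "h = map_sum id q" "q permutes {..<d} \<times> {..<m}"
    using assms(1) by (auto simp: E1_Cd_perms_def product_perms_def identity_perms_def composition_perms_def)
  then show ?thesis using assms(2) permutes_in_image[of q "{..<d} \<times> {..<m}"]
    by (auto simp: E1_Cd_points_def simp del: mem_Sigma_iff)
qed

section \<open>Maps on the bouquet\<close>

definition outer_verts :: "nat \<Rightarrow> vertex set" where
  "outer_verts n = Av ` {1..n} \<union> Av' ` {1..n}"

fun pairing :: "nat \<Rightarrow> vertex \<Rightarrow> vertex" where
  "pairing n Center = Center"
| "pairing n (Av i) = (if i \<in> {1..n} then Av' i else Av i)"
| "pairing n (Av' i) = (if i \<in> {1..n} then Av i else Av' i)"

lemma bouquet_verts_eq: "bouquet_verts n = insert Center (outer_verts n)"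
  by (auto simp: bouquet_verts_def outer_verts_def)

lemma Center_notin_outer_verts: "Center \<notin> outer_verts n"
  by (auto simp: outer_verts_def)

lemma card_outer_verts: "card (outer_verts n) = 2 * n"
proof -
  have "card (outer_verts n) = card (Av ` {1..n}) + card (Av' ` {1..n})"
    unfolding outer_verts_def by (rule card_Un_disjoint) auto
  then show ?thesis by (simp add: card_image inj_on_def)
qed

lemma finite_outer_verts: "finite (outer_verts n)"
  by (simp add: outer_verts_def)

lemma pairing_involution: "pairing n \<in> involutions_commuting (outer_verts n) id"
  unfolding involutions_commuting_iff
proof (intro conjI allI impI ballI)
  fix x assume "x \<notin> outer_verts n"
  then show "pairing n x = x" by (cases x) (auto simp: outer_verts_def)
qed (auto simp: outer_verts_def)

lemma neighborhood_Center: "neighborhood n Center = outer_verts n"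
  by (auto simp: neighborhood_def bouquet_edges_def outer_verts_def doubleton_eq_iff)

lemma neighborhood_outer:
  assumes "v \<in> outer_verts n"
  shows "neighborhood n v = {Center, pairing n v}"
  using assms by (auto simp: neighborhood_def bouquet_edges_def outer_verts_def doubleton_eq_iff)

lemma permutes_outer_verts_iff:
  "\<gamma> permutes outer_verts n \<longleftrightarrow> \<gamma> permutes bouquet_verts n \<and> \<gamma> Center = Center"
proof
  assume "\<gamma> permutes outer_verts n"
  then show "\<gamma> permutes bouquet_verts n \<and> \<gamma> Center = Center"
    using Center_notin_outer_verts by (auto simp: bouquet_verts_eq permutes_not_in intro: permutes_subset)
next
  assume "\<gamma> permutes bouquet_verts n \<and> \<gamma> Center = Center"
  then show "\<gamma> permutes outer_verts n"
    by (auto simp: bouquet_verts_eq intro: permutes_superset)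
qed

text \<open>The pairs are the orbits of \<open>pairing n\<close>. A bijection carrying a two-point
  orbit onto another does so in one of two ways, and both commute with the exchange of the two
  points.\<close>

lemma carrier_Gamma: "carrier (Gamma n) = centralizer (outer_verts n) (pairing n)"
proof -
  have "(\<forall>i\<in>{1..n}. \<exists>j\<in>{1..n}. \<gamma> ` {Av i, Av' i} = {Av j, Av' j}) \<longleftrightarrow>
      \<gamma> \<circ> pairing n = pairing n \<circ> \<gamma>" if \<gamma>: "\<gamma> permutes outer_verts n" for \<gamma>
  proof
    assume *: "\<forall>i\<in>{1..n}. \<exists>j\<in>{1..n}. \<gamma> ` {Av i, Av' i} = {Av j, Av' j}"
    have "\<gamma> (pairing n x) = pairing n (\<gamma> x)" for x
    proof (cases "x \<in> outer_verts n")
      case True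
      then obtain i where i: "i \<in> {1..n}" "x = Av i \<or> x = Av' i"
        by (auto simp: outer_verts_def)
      then obtain j where j: "j \<in> {1..n}" "\<gamma> ` {Av i, Av' i} = {Av j, Av' j}" using * by blast
      then have "\<gamma> (Av i) = Av j \<and> \<gamma> (Av' i) = Av' j \<or> \<gamma> (Av i) = Av' j \<and> \<gamma> (Av' i) = Av j"
        by (auto simp: doubleton_eq_iff)
      then show ?thesis using i j(1) by auto
    next
      case False
      then have "pairing n x = x"
        using pairing_involution by (auto simp: involutions_commuting_iff)
      then show ?thesis using \<gamma> False by (simp add: permutes_not_in)
    qed
    then show "\<gamma> \<circ> pairing n = pairing n \<circ> \<gamma>" by auto
  next
    assume comm: "\<gamma> \<circ> pairing n = pairing n \<circ> \<gamma>"
    show "\<forall>i\<in>{1..n}. \<exists>j\<in>{1..n}. \<gamma> ` {Av i, Av' i} = {Av j, Av' j}"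
    proof
      fix i assume i: "i \<in> {1..n}"
      then have "\<gamma> (Av i) \<in> outer_verts n"
        using \<gamma> by (simp add: permutes_in_image) (simp add: outer_verts_def)
      then obtain j where j: "j \<in> {1..n}" "\<gamma> (Av i) = Av j \<or> \<gamma> (Av i) = Av' j"
        by (auto simp: outer_verts_def)
      moreover have "\<gamma> (Av' i) = pairing n (\<gamma> (Av i))"
        using fun_cong[OF comm, of "Av i"] i by simp
      ultimately show "\<exists>j\<in>{1..n}. \<gamma> ` {Av i, Av' i} = {Av j, Av' j}" by auto
    qed
  qed
  then show ?thesis
    unfolding Gamma_def centralizer_def by (auto simp: permutes_outer_verts_iff)
qed

text \<open>This is what forces the rotations at the outer vertices: each has just two
  neighbors.\<close>

lemma rotation_doubleton_iff:
  assumes "a \<noteq> b"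
  shows "is_rotation {a, b} p \<longleftrightarrow> p = Transposition.transpose a b"
proof
  assume "is_rotation {a, b} p"
  then interpret rotation "{a, b}" p by unfold_locales
  have neq: "p x \<noteq> x" if "x \<in> {a, b}" for x
    using funpow_fixed_iff[OF that, of 1] assms by simp
  have "p a = b" "p b = a" using neq r_in by auto
  then show "p = Transposition.transpose a b"
    using permutes_not_in[OF permutes] by (auto simp: fun_eq_iff Transposition.transpose_def)
next
  assume p: "p = Transposition.transpose a b"
  have perm: "p permutes {a, b}" unfolding p by (rule permutes_swap_id) auto
  have "p a = b" "p b = a" by (simp_all add: p)
  then have "{a, b} \<subseteq> Orbits.orbit p a" by (metis orbit.base orbit.step empty_subsetI insert_subset)
  then have "{a, b} = Orbits.orbit p a" using permutes_orbit_subset[OF perm] by blast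
  then show "is_rotation {a, b} p" using perm by (auto simp: is_rotation_def cyclic_on_def)
qed

section \<open>Maps as rotations at the center\<close>

definition map_of_rotation :: "nat \<Rightarrow> (vertex \<Rightarrow> vertex) \<Rightarrow> vertex \<Rightarrow> vertex \<Rightarrow> vertex" where
  "map_of_rotation n \<sigma> = (\<lambda>v. if v = Center then \<sigma>
     else if v \<in> outer_verts n then Transposition.transpose Center (pairing n v) else id)"

lemma bouquet_maps_iff:
  "\<rho> \<in> bouquet_maps n \<longleftrightarrow> is_rotation (outer_verts n) (\<rho> Center) \<and> \<rho> = map_of_rotation n (\<rho> Center)"
proof -
  have "pairing n v \<noteq> Center" if "v \<in> outer_verts n" for v
    using that by (auto simp: outer_verts_def)
  then have "is_rotation (neighborhood n v) p \<longleftrightarrow> p = Transposition.transpose Center (pairing n v)"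
    if "v \<in> outer_verts n" for v p
    using that by (simp add: neighborhood_outer rotation_doubleton_iff[OF not_sym])
  then show ?thesis
    unfolding bouquet_maps_def map_of_rotation_def bouquet_verts_eq
    using Center_notin_outer_verts[of n]
    by (auto simp: fun_eq_iff neighborhood_Center)
qed

lemma bouquet_maps_eq_iff:
  assumes "\<rho> \<in> bouquet_maps n" "\<rho>' \<in> bouquet_maps n"
  shows "\<rho> = \<rho>' \<longleftrightarrow> \<rho> Center = \<rho>' Center"
  using assms unfolding bouquet_maps_iff by metis

lemma bij_betw_bouquet_maps:
  "bij_betw (\<lambda>\<rho>. \<rho> Center) {\<rho> \<in> bouquet_maps n. P (\<rho> Center)}
     {\<sigma>. is_rotation (outer_verts n) \<sigma> \<and> P \<sigma>}"
proof (rule bij_betw_byWitness[where f' = "map_of_rotation n"])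
  have [simp]: "map_of_rotation n \<sigma> Center = \<sigma>" for \<sigma> by (simp add: map_of_rotation_def)
  show "\<forall>\<rho>\<in>{\<rho> \<in> bouquet_maps n. P (\<rho> Center)}. map_of_rotation n (\<rho> Center) = \<rho>"
    using bouquet_maps_iff by auto
qed (auto simp: bouquet_maps_iff map_of_rotation_def)

lemma finite_bouquet_maps: "finite (bouquet_maps n)"
proof -
  have "finite {\<sigma>. is_rotation (outer_verts n) \<sigma> \<and> True}"
    by (rule finite_subset[OF _ finite_permutations[OF finite_outer_verts]]) (auto simp: is_rotation_def)
  then show ?thesis using bij_betw_finite[OF bij_betw_bouquet_maps[of n "\<lambda>_. True"]] by simp
qed

section \<open>The action on maps\<close>

lemma Gamma_permutes:
  assumes "\<gamma> \<in> carrier (Gamma n)"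
  shows "\<gamma> permutes outer_verts n" "bij \<gamma>" "\<gamma> Center = Center"
    and "\<gamma> (pairing n x) = pairing n (\<gamma> x)"
  using assms Center_notin_outer_verts[of n]
  by (auto simp: carrier_Gamma centralizer_def permutes_bij permutes_not_in fun_eq_iff)

lemma Gamma_inv_closed:
  assumes "\<gamma> \<in> carrier (Gamma n)"
  shows "inv_into UNIV \<gamma> \<in> carrier (Gamma n)"
proof -
  note \<gamma> = Gamma_permutes[OF assms]
  have "inv_into UNIV \<gamma> (pairing n x) = pairing n (inv_into UNIV \<gamma> x)" for x
    using \<gamma>(2) \<gamma>(4)[of "inv_into UNIV \<gamma> x"] by (metis bij_inv_eq_iff)
  then show ?thesis
    using \<gamma>(1) by (auto simp: carrier_Gamma centralizer_def permutes_inv)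
qed

lemma group_Gamma: "group (Gamma n)"
proof (rule groupI)
  fix \<gamma> assume \<gamma>: "\<gamma> \<in> carrier (Gamma n)"
  then have "inv_into UNIV \<gamma> \<otimes>\<^bsub>Gamma n\<^esub> \<gamma> = \<one>\<^bsub>Gamma n\<^esub>"
    using permutes_inv_o(2)[OF Gamma_permutes(1)[OF \<gamma>]] by (simp add: Gamma_def)
  then show "\<exists>\<delta>\<in>carrier (Gamma n). \<delta> \<otimes>\<^bsub>Gamma n\<^esub> \<gamma> = \<one>\<^bsub>Gamma n\<^esub>"
    using Gamma_inv_closed[OF \<gamma>] by blast
next
  fix \<gamma> \<delta> assume "\<gamma> \<in> carrier (Gamma n)" "\<delta> \<in> carrier (Gamma n)"
  then have "\<gamma> \<circ> \<delta> \<in> carrier (Gamma n)"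
    unfolding carrier_Gamma by (auto simp: centralizer_def permutes_compose fun_eq_iff)
  then show "\<gamma> \<otimes>\<^bsub>Gamma n\<^esub> \<delta> \<in> carrier (Gamma n)" by (simp add: Gamma_def)
next
  have "id \<in> carrier (Gamma n)" by (simp add: carrier_Gamma centralizer_def permutes_id)
  then show "\<one>\<^bsub>Gamma n\<^esub> \<in> carrier (Gamma n)" by (simp add: Gamma_def)
qed (auto simp: Gamma_def)

lemma map_action_apply:
  assumes "\<rho> \<in> bouquet_maps n"
  shows "map_action n \<gamma> \<rho> w = perm_conj \<gamma> (\<rho> (inv_into UNIV \<gamma> w))"
  using assms by (simp add: map_action_def perm_conj_def)

lemma Gamma_neighborhood:
  assumes "\<gamma> \<in> carrier (Gamma n)" "v \<in> bouquet_verts n"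
  shows "\<gamma> ` neighborhood n v = neighborhood n (\<gamma> v)"
proof (cases "v = Center")
  case True
  then show ?thesis using Gamma_permutes[OF assms(1)] by (simp add: neighborhood_Center permutes_image)
next
  case False
  then have "v \<in> outer_verts n" using assms(2) by (simp add: bouquet_verts_eq)
  moreover from this have "\<gamma> v \<in> outer_verts n"
    using Gamma_permutes(1)[OF assms(1)] by (simp add: permutes_in_image)
  ultimately show ?thesis using Gamma_permutes[OF assms(1)] by (simp add: neighborhood_outer)
qed

lemma map_action_closed:
  assumes \<gamma>: "\<gamma> \<in> carrier (Gamma n)" and \<rho>: "\<rho> \<in> bouquet_maps n"
  shows "map_action n \<gamma> \<rho> \<in> bouquet_maps n"
proof -
  have perm: "\<gamma> permutes bouquet_verts n" and bij: "bij \<gamma>"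
    using Gamma_permutes[OF \<gamma>] by (auto simp: permutes_outer_verts_iff)
  have "is_rotation (neighborhood n v) (map_action n \<gamma> \<rho> v)" if v: "v \<in> bouquet_verts n" for v
  proof -
    let ?u = "inv_into UNIV \<gamma> v"
    have u: "?u \<in> bouquet_verts n" "\<gamma> ?u = v"
      using v perm permutes_in_image[OF permutes_inv[OF perm]] by (simp_all add: permutes_inverses)
    then have "is_rotation (neighborhood n ?u) (\<rho> ?u)" using \<rho> by (simp add: bouquet_maps_def)
    then have "is_rotation (\<gamma> ` neighborhood n ?u) (perm_conj \<gamma> (\<rho> ?u))"
      by (rule is_rotation_perm_conj[OF perm])
    then show ?thesis using \<rho> u Gamma_neighborhood[OF \<gamma> u(1)] by (simp add: map_action_apply)
  qed
  moreover have "map_action n \<gamma> \<rho> v = id" if v: "v \<notin> bouquet_verts n" for v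
  proof -
    have "inv_into UNIV \<gamma> v = v" using permutes_not_in[OF permutes_inv[OF perm] v] .
    then have "map_action n \<gamma> \<rho> v = perm_conj \<gamma> id"
      using \<rho> v by (simp add: map_action_apply) (simp add: bouquet_maps_def)
    then show ?thesis using bij by (simp add: perm_conj_eq_iff)
  qed
  ultimately show ?thesis by (simp add: bouquet_maps_def)
qed

text \<open>Since \<gamma> fixes \<open>Center\<close>, the action is plain conjugation there.
  Together with \<open>bouquet_maps_eq_iff\<close> this reduces identities between maps to
  identities between conjugates.\<close>

lemma map_action_Center:
  assumes "\<gamma> \<in> carrier (Gamma n)" "\<rho> \<in> bouquet_maps n"
  shows "map_action n \<gamma> \<rho> Center = perm_conj \<gamma> (\<rho> Center)"
proof -
  have "inv_into UNIV \<gamma> Center = Center"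
    using Gamma_permutes[OF assms(1)] by (metis bij_inv_eq_iff)
  then show ?thesis using assms by (simp add: map_action_apply)
qed

lemma map_action_comp:
  assumes \<gamma>: "\<gamma> \<in> carrier (Gamma n)" and \<delta>: "\<delta> \<in> carrier (Gamma n)"
    and \<rho>: "\<rho> \<in> bouquet_maps n" and comp: "\<gamma> \<circ> \<delta> \<in> carrier (Gamma n)"
  shows "map_action n (\<gamma> \<circ> \<delta>) \<rho> = map_action n \<gamma> (map_action n \<delta> \<rho>)"
proof -
  have "map_action n (\<gamma> \<circ> \<delta>) \<rho> Center = map_action n \<gamma> (map_action n \<delta> \<rho>) Center"
    using assms by (simp add: map_action_Center map_action_closed perm_conj_comp Gamma_permutes)
  then show ?thesis using bouquet_maps_eq_iff map_action_closed assms by metis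
qed

lemma group_action_Gamma: "group_action (Gamma n) (bouquet_maps n) (map_action n)"
proof -
  interpret G: group "Gamma n" by (rule group_Gamma)
  let ?M = "bouquet_maps n"
  have Bij: "map_action n \<gamma> \<in> Bij ?M" if \<gamma>: "\<gamma> \<in> carrier (Gamma n)" for \<gamma>
  proof -
    note i = Gamma_inv_closed[OF \<gamma>]
    have "bij \<gamma>" using Gamma_permutes(2)[OF \<gamma>] .
    then have inv: "perm_conj (inv_into UNIV \<gamma>) (perm_conj \<gamma> \<omega>) = \<omega>"
      "perm_conj \<gamma> (perm_conj (inv_into UNIV \<gamma>) \<omega>) = \<omega>" for \<omega>
      by (simp_all add: perm_conj_inv)
    have "map_action n (inv_into UNIV \<gamma>) (map_action n \<gamma> \<rho>) = \<rho>"
      "map_action n \<gamma> (map_action n (inv_into UNIV \<gamma>) \<rho>) = \<rho>" if "\<rho> \<in> ?M" for \<rho>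
      using that \<gamma> i by (simp_all add: bouquet_maps_eq_iff[of _ n] map_action_closed map_action_Center inv)
    then have "bij_betw (map_action n \<gamma>) ?M ?M"
      using map_action_closed \<gamma> i by (intro bij_betw_byWitness[where f' = "map_action n (inv_into UNIV \<gamma>)"]) auto
    moreover have "map_action n \<gamma> \<in> extensional ?M" by (simp add: map_action_def)
    ultimately show ?thesis by (simp add: Bij_def)
  qed
  have "map_action n \<in> hom (Gamma n) (BijGroup ?M)"
  proof (rule homI)
    fix \<gamma> \<delta> assume \<gamma>\<delta>: "\<gamma> \<in> carrier (Gamma n)" "\<delta> \<in> carrier (Gamma n)"
    have eq: "\<gamma> \<otimes>\<^bsub>Gamma n\<^esub> \<delta> = \<gamma> \<circ> \<delta>" by (simp add: Gamma_def)
    have comp: "\<gamma> \<circ> \<delta> \<in> carrier (Gamma n)" using G.m_closed[OF \<gamma>\<delta>] eq by simp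
    have "map_action n (\<gamma> \<circ> \<delta>) = compose ?M (map_action n \<gamma>) (map_action n \<delta>)"
    proof
      fix \<rho>
      show "map_action n (\<gamma> \<circ> \<delta>) \<rho> = compose ?M (map_action n \<gamma>) (map_action n \<delta>) \<rho>"
        using map_action_comp[OF \<gamma>\<delta> _ comp] by (cases "\<rho> \<in> ?M") (simp_all add: compose_def map_action_def)
    qed
    then show "map_action n (\<gamma> \<otimes>\<^bsub>Gamma n\<^esub> \<delta>) = map_action n \<gamma> \<otimes>\<^bsub>BijGroup ?M\<^esub> map_action n \<delta>"
      using Bij \<gamma>\<delta> eq by (simp add: BijGroup_def)
  qed (simp add: BijGroup_def Bij)
  then show ?thesis
    by (simp add: group_action_def group_hom_def group_hom_axioms_def group_Gamma group_BijGroup)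
qed

section \<open>Automorphism groups of maps and the final count\<close>

lemma stabilizer_eq:
  assumes "\<rho> \<in> bouquet_maps n"
  shows "stabilizer (Gamma n) (map_action n) \<rho> =
    centralizer (outer_verts n) (\<rho> Center) \<inter> centralizer (outer_verts n) (pairing n)"
proof -
  have "map_action n \<gamma> \<rho> = \<rho> \<longleftrightarrow> \<gamma> \<in> centralizer (outer_verts n) (\<rho> Center)"
    if \<gamma>: "\<gamma> \<in> carrier (Gamma n)" for \<gamma>
  proof -
    have "map_action n \<gamma> \<rho> = \<rho> \<longleftrightarrow> perm_conj \<gamma> (\<rho> Center) = \<rho> Center"
      using bouquet_maps_eq_iff[OF map_action_closed[OF \<gamma> assms] assms] map_action_Center[OF \<gamma> assms]
      by simp
    then show ?thesis
      unfolding perm_conj_eq_iff[OF Gamma_permutes(2)[OF \<gamma>]]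
      using Gamma_permutes(1)[OF \<gamma>] by (simp add: centralizer_def fun_eq_iff)
  qed
  then show ?thesis unfolding stabilizer_def carrier_Gamma by blast
qed

lemma cyclic_map_aut_group:
  assumes \<rho>: "\<rho> \<in> bouquet_maps n"
  shows "cyclic_group (map_aut_group n \<rho>)"
proof -
  interpret group_action "Gamma n" "bouquet_maps n" "map_action n" by (rule group_action_Gamma)
  interpret rotation "outer_verts n" "\<rho> Center"
    by unfold_locales (use \<rho> in \<open>simp add: bouquet_maps_iff\<close>)
  let ?H = "map_aut_group n \<rho>" and ?\<sigma> = "\<rho> Center"
  have grp: "group ?H"
    unfolding map_aut_group_def
    by (rule subgroup.subgroup_is_group[OF stabilizer_subgroup[OF \<rho>] group_Gamma])
  have "pairing n permutes outer_verts n"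
    using pairing_involution by (simp add: involutions_commuting_def)
  then obtain g e where ge: "g * e = card (outer_verts n)" "carrier ?H = (\<lambda>i. ?\<sigma> ^^ (g * i)) ` {..<e}"
    using common_centralizer stabilizer_eq[OF \<rho>] by (simp add: map_aut_group_def) metis
  \<comment> \<open>The generator must be written with an index below e. For e = 1 this is i = 0, as
    g is then the length of the cycle and \<sigma>^g is the identity; otherwise it is i = 1.\<close>
  have "\<exists>i<e. ?\<sigma> ^^ g = ?\<sigma> ^^ (g * i)"
  proof (cases "e = 1")
    case True
    then show ?thesis unfolding funpow_perm_eq_iff ge(1)[symmetric] by auto
  next
    case False
    then show ?thesis using ge(1) k_pos by (intro exI[of _ 1]) (cases e, auto)
  qed
  then have gen: "?\<sigma> ^^ g \<in> carrier ?H" using ge(2) by blast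
  have pow: "(?\<sigma> ^^ g) [^]\<^bsub>?H\<^esub> (i::nat) = ?\<sigma> ^^ (g * i)" for i
    by (induction i)
      (simp_all add: nat_pow_def map_aut_group_def Gamma_def add.commute
        flip: funpow_add)
  interpret H: group ?H by (rule grp)
  have "carrier ?H = range (\<lambda>i::int. (?\<sigma> ^^ g) [^]\<^bsub>?H\<^esub> i)"
  proof (intro equalityI subsetI)
    fix \<gamma> assume "\<gamma> \<in> carrier ?H"
    then obtain i where "\<gamma> = (?\<sigma> ^^ g) [^]\<^bsub>?H\<^esub> (i::nat)" using ge(2) pow by auto
    then have "\<gamma> = (?\<sigma> ^^ g) [^]\<^bsub>?H\<^esub> int i" by (simp add: int_pow_int)
    then show "\<gamma> \<in> range (\<lambda>i::int. (?\<sigma> ^^ g) [^]\<^bsub>?H\<^esub> i)" by blast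
  qed (use H.int_pow_closed[OF gen] in auto)
  then show ?thesis unfolding H.cyclic_group using gen by blast
qed

lemma fold_symmetric_iff:
  assumes "\<rho> \<in> bouquet_maps n"
  shows "fold_symmetric n d \<rho> \<longleftrightarrow> card (stabilizer (Gamma n) (map_action n) \<rho>) = d"
  using cyclic_map_aut_group[OF assms] by (simp add: fold_symmetric_def map_aut_group_def order_def)

text \<open>One direction is the coordinate system above. For the other, the powers of
  \<sigma>^(2n/d) serve as a comparison group: it has d elements and is isomorphic to the same
  model, so the automorphism group has d elements as well.\<close>

lemma fold_symmetric_iff_perm_isomorphic:
  assumes "n \<ge> 1" "d dvd 2 * n" and \<rho>: "\<rho> \<in> bouquet_maps n"
  shows "fold_symmetric n d \<rho> \<longleftrightarrow>
    perm_isomorphic (bouquet_verts n) (carrier (map_aut_group n \<rho>))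
      (E1_Cd_points d (2 * n div d)) (E1_Cd_perms d (2 * n div d))"
proof -
  let ?N = "outer_verts n" and ?\<sigma> = "\<rho> Center" and ?C = "carrier (map_aut_group n \<rho>)"
  have rot: "is_rotation ?N ?\<sigma>" using \<rho> by (simp add: bouquet_maps_iff)
  interpret rotation ?N ?\<sigma> by unfold_locales (rule rot)
  have "d > 0" using assms(1,2) by (auto intro: Nat.gr0I)
  have "pairing n permutes ?N"
    using pairing_involution by (simp add: involutions_commuting_def)
  then obtain g e where ge: "g * e = card ?N" "card ?C = e" "?C = (\<lambda>i. ?\<sigma> ^^ (g * i)) ` {..<e}"
    using common_centralizer stabilizer_eq[OF \<rho>] by (simp add: map_aut_group_def) metis
  have fold: "fold_symmetric n d \<rho> \<longleftrightarrow> e = d"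
    using ge(2) fold_symmetric_iff[OF \<rho>] by (simp add: map_aut_group_def)
  show ?thesis unfolding fold
  proof
    assume "e = d"
    then have "2 * n = g * d" using ge(1) card_outer_verts by metis
    then have "g = 2 * n div d" using \<open>d > 0\<close> by simp
    then show "perm_isomorphic (bouquet_verts n) ?C (E1_Cd_points d (2 * n div d)) (E1_Cd_perms d (2 * n div d))"
      using perm_isomorphic_rotation_powers[OF rot ge(1) Center_notin_outer_verts] ge(3) \<open>e = d\<close>
      by (simp add: bouquet_verts_eq)
  next
    let ?C' = "(\<lambda>i. ?\<sigma> ^^ (2 * n div d * i)) ` {..<d}" and ?Y = "E1_Cd_points d (2 * n div d)"
      and ?H = "E1_Cd_perms d (2 * n div d)"
    assume iso: "perm_isomorphic (bouquet_verts n) ?C ?Y ?H"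
    have gd: "2 * n div d * d = card ?N" using assms(2) by (simp add: card_outer_verts)
    have iso': "perm_isomorphic (bouquet_verts n) ?C' ?Y ?H"
      using perm_isomorphic_rotation_powers[OF rot gd Center_notin_outer_verts]
      by (simp add: bouquet_verts_eq)
    have "finite (bouquet_verts n)" by (simp add: bouquet_verts_def)
    then have "card ?C = card ?C'"
      using card_perm_isomorphic_le[OF iso iso'] card_perm_isomorphic_le[OF iso' iso]
        E1_Cd_perms_closed by (intro le_antisym) blast+
    also have "card ?C' = d"
    proof -
      have "2 * n div d > 0" using gd k_pos by (auto intro: Nat.gr0I)
      then have "inj_on (\<lambda>i. ?\<sigma> ^^ (2 * n div d * i)) {..<d}"
        by (auto simp: inj_on_def funpow_perm_eq_iff gd[symmetric] simp del: dvd_div_mult_self)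
      then show ?thesis by (simp add: card_image)
    qed
    finally show "e = d" using ge(2) by simp
  qed
qed

text \<open>The maps with stabilizer of order d form a union of orbits, each with |\<Gamma>|/d
  members, so counting these maps counts the orbits.\<close>

lemma num_fold_symmetric_mult_order:
  "num_fold_symmetric n d * card (carrier (Gamma n)) = d *
     card {\<sigma>. is_rotation (outer_verts n) \<sigma> \<and>
       card (centralizer (outer_verts n) \<sigma> \<inter> centralizer (outer_verts n) (pairing n)) = d}"
proof -
  interpret group_action "Gamma n" "bouquet_maps n" "map_action n" by (rule group_action_Gamma)
  let ?M = "bouquet_maps n" and ?stab = "stabilizer (Gamma n) (map_action n)"
    and ?orb = "Group_Action.orbit (Gamma n) (map_action n)"
  let ?F = "{\<rho> \<in> ?M. card (?stab \<rho>) = d}"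
  let ?O = "{X \<in> unlabeled_imbeddings n. \<exists>\<rho>\<in>X. fold_symmetric n d \<rho>}"
  have sub: "X \<subseteq> ?M" if "X \<in> unlabeled_imbeddings n" for X
    using that orbits_coverture unfolding unlabeled_imbeddings_def by blast
  have orb: "X = ?orb \<rho>" if "X \<in> unlabeled_imbeddings n" "\<rho> \<in> X" for X \<rho>
  proof -
    have "\<rho> \<in> ?M" using sub that by blast
    then have "?orb \<rho> \<in> orbits (Gamma n) ?M (map_action n)" "\<rho> \<in> ?orb \<rho>"
      by (auto simp: orbits_def orbit_refl)
    then show ?thesis using disjoint_union that unfolding unlabeled_imbeddings_def by blast
  qed
  have card_X: "card X * card (?stab \<rho>) = card (carrier (Gamma n))"
    if "X \<in> unlabeled_imbeddings n" "\<rho> \<in> X" for X \<rho>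
    using orbit_stabilizer_theorem[of \<rho>] orb[OF that] sub[OF that(1)] that(2) by (auto simp: order_def)
  have fin: "finite X" if "X \<in> unlabeled_imbeddings n" for X
    using sub[OF that] finite_bouquet_maps finite_subset by blast
  have fin_O: "finite ?O"
    using sub by (intro finite_subset[OF _ finite_Pow_iff[THEN iffD2, OF finite_bouquet_maps]]) auto
  have O: "X \<subseteq> ?F \<and> card X * d = card (carrier (Gamma n))" if X_in: "X \<in> ?O" for X
  proof -
    obtain \<rho> where \<rho>: "\<rho> \<in> X" "fold_symmetric n d \<rho>" and X: "X \<in> unlabeled_imbeddings n"
      using X_in by blast
    have d: "card X * d = card (carrier (Gamma n))"
      using card_X[OF X \<rho>(1)] fold_symmetric_iff \<rho> sub[OF X] by auto
    have "card X > 0" using fin[OF X] \<rho>(1) by (auto simp: card_gt_0_iff)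
    \<comment> \<open>Constancy along an orbit is read off from the orbit-stabilizer product, with
      no conjugation of stabilizers.\<close>
    then have "card (?stab \<rho>') = d" if "\<rho>' \<in> X" for \<rho>'
      using card_X[OF X that] d by (metis mult_cancel1 less_numeral_extra(3))
    then show ?thesis using d sub[OF X] by blast
  qed
  have "?F = \<Union>?O"
  proof (intro equalityI subsetI)
    fix \<rho> assume "\<rho> \<in> ?F"
    then have "?orb \<rho> \<in> ?O" "\<rho> \<in> ?orb \<rho>"
      using orbit_refl fold_symmetric_iff unfolding unlabeled_imbeddings_def orbits_def by blast+
    then show "\<rho> \<in> \<Union>?O" by blast
  qed (use O in blast)
  then have "card ?F = card (\<Union>?O)" by simp
  also have "\<dots> = (\<Sum>X\<in>?O. card X)"
  proof (rule card_Union_disjoint)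
    show "pairwise disjnt ?O"
      using disjoint_union unfolding pairwise_def disjnt_def unlabeled_imbeddings_def by blast
  qed (use fin in blast)
  finally have "d * card ?F = (\<Sum>X\<in>?O. card X * d)"
    by (simp add: sum_distrib_left mult.commute)
  also have "\<dots> = card ?O * card (carrier (Gamma n))" using O by simp
  finally have "num_fold_symmetric n d * card (carrier (Gamma n)) = d * card ?F"
    by (simp add: num_fold_symmetric_def)
  also have "?F = {\<rho> \<in> ?M. card (centralizer (outer_verts n) (\<rho> Center) \<inter>
      centralizer (outer_verts n) (pairing n)) = d}"
    using stabilizer_eq by auto
  also have "card \<dots> = card {\<sigma>. is_rotation (outer_verts n) \<sigma> \<and>
       card (centralizer (outer_verts n) \<sigma> \<inter> centralizer (outer_verts n) (pairing n)) = d}"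
    by (rule bij_betw_same_card[OF bij_betw_bouquet_maps])
  finally show ?thesis .
qed

text \<open>Provides the fixed reference cycle against which the involutions are counted.\<close>

lemma rotation_exists:
  assumes "finite N" "N \<noteq> {}"
  obtains \<sigma> where "is_rotation N \<sigma>"
proof -
  obtain xs where xs: "set xs = N" "distinct xs" using finite_distinct_list[OF assms(1)] by blast
  let ?\<sigma> = "cycle_of_list xs"
  have "xs \<noteq> []" using xs assms(2) by auto
  have perm: "?\<sigma> permutes N" using cycle_permutes[of xs] xs by simp
  have "y \<in> Orbits.orbit ?\<sigma> (xs ! 0)" if y: "y \<in> N" for y
  proof -
    obtain i where i: "i < length xs" "y = xs ! i" using y xs by (auto simp: in_set_conv_nth)
    \<comment> \<open>Rotating the list i times brings its i-th entry to the head, so that entry is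
      the i-th iterate of the first one.\<close>
    have "map (?\<sigma> ^^ i) xs ! 0 = rotate i xs ! 0" by (simp only: cyclic_rotation[OF xs(2)])
    then have "(?\<sigma> ^^ i) (xs ! 0) = y" using \<open>xs \<noteq> []\<close> i by (simp add: nth_rotate)
    then show ?thesis unfolding orbit_altdef_permutation[OF permutation_of_cycle] by blast
  qed
  moreover have "xs ! 0 \<in> N" using \<open>xs \<noteq> []\<close> xs(1) nth_mem[of 0 xs] by simp
  ultimately have "N = Orbits.orbit ?\<sigma> (xs ! 0)"
    using permutes_orbit_subset[OF perm] by blast
  then have "cyclic_on ?\<sigma> N" using \<open>xs ! 0 \<in> N\<close> unfolding cyclic_on_def by blast
  then have "is_rotation N ?\<sigma>" using perm unfolding is_rotation_def by blast
  then show ?thesis by (rule that)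
qed

lemma num_fold_symmetric_eq:
  assumes "n \<ge> 1" "d dvd 2 * n"
  shows "real (num_fold_symmetric n d) =
    real d * (\<Sum>k | d dvd k \<and> k dvd 2 * n. f_term n k * of_int (moebius_mu (k div d)))"
proof -
  let ?N = "outer_verts n" and ?\<tau> = "pairing n"
  have card_N: "card ?N = 2 * n" by (rule card_outer_verts)
  then have "?N \<noteq> {}" using assms(1) by auto
  then obtain \<sigma> where \<sigma>: "is_rotation ?N \<sigma>" using rotation_exists finite_outer_verts by metis
  define M where "M e = card {\<tau> \<in> involutions_commuting ?N id.
    card (centralizer ?N \<sigma> \<inter> centralizer ?N \<tau>) = e}" for e
  have G: "card (carrier (Gamma n)) > 0"
  proof -
    have "finite (carrier (Gamma n))"
      by (rule finite_subset[OF _ finite_permutations[OF finite_outer_verts[of n]]])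
        (auto simp: carrier_Gamma centralizer_def)
    moreover have "id \<in> carrier (Gamma n)" by (simp add: carrier_Gamma centralizer_def permutes_id)
    ultimately show ?thesis by (auto simp: card_gt_0_iff)
  qed
  \<comment> \<open>The count \<open>S\<close> of rotations links both sides: the orbit count equals
    d S / |\<Gamma>|, and the exchange of roles gives 2n S = |\<Gamma>| M(d).\<close>
  have "(2 * n * num_fold_symmetric n d) * card (carrier (Gamma n)) =
      (d * M d) * card (carrier (Gamma n))"
  proof -
    define S where "S = card {\<sigma>'. is_rotation ?N \<sigma>' \<and> card (centralizer ?N \<sigma>' \<inter> centralizer ?N ?\<tau>) = d}"
    have "num_fold_symmetric n d * card (carrier (Gamma n)) = d * S"
      unfolding S_def by (rule num_fold_symmetric_mult_order)
    moreover have "2 * n * S = card (carrier (Gamma n)) * M d"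
      unfolding S_def M_def carrier_Gamma card_N[symmetric]
      by (rule card_rotations_exchange[OF \<sigma> pairing_involution])
    ultimately show ?thesis by (metis mult.assoc mult.commute)
  qed
  then have "2 * n * num_fold_symmetric n d = d * M d" using G by simp
  then have "real (2 * n) * real (num_fold_symmetric n d) = real d * real (M d)"
    by (metis of_nat_mult)
  also have "real (M d) =
      (\<Sum>k | d dvd k \<and> k dvd 2 * n. real (2 * n) * f_term n k * of_int (moebius_mu (k div d)))"
  \<comment> \<open>The function summed over multiples is 2n f(n, k), the number of involutions
    commuting with \<sigma>^(2n/k).\<close>
  proof (rule moebius_inversion_multiples[where M = "\<lambda>e. real (M e)"])
    fix k assume k: "k dvd 2 * n"
    then have "2 * n div k * k = card ?N" by (simp add: card_N)
    then have "invariant_matchings k (2 * n div k) = (\<Sum>e | k dvd e \<and> e dvd 2 * n. M e)"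
      using card_involutions_eq_sum[OF \<sigma>] unfolding M_def card_N by blast
    then show "real (2 * n) * f_term n k = (\<Sum>e | k dvd e \<and> e dvd 2 * n. real (M e))"
      using f_term_eq_invariant_matchings[OF _ k] assms(1) by simp
  qed (use assms in auto)
  also have "\<dots> = real (2 * n) * (\<Sum>k | d dvd k \<and> k dvd 2 * n. f_term n k * of_int (moebius_mu (k div d)))"
    by (simp add: sum_distrib_left mult.assoc)
  finally have "real (2 * n) * real (num_fold_symmetric n d) = real (2 * n) *
      (real d * (\<Sum>k | d dvd k \<and> k dvd 2 * n. f_term n k * of_int (moebius_mu (k div d))))"
    by (simp only: mult.left_commute)
  then show ?thesis using assms(1) by simp
qed

theorem theorem13:
  fixes n d :: nat
  assumes "n \<ge> 1" and "d dvd 2 * n"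
  shows "(\<forall>\<rho>\<in>bouquet_maps n. fold_symmetric n d \<rho> \<longleftrightarrow>
            perm_isomorphic (bouquet_verts n) (carrier (map_aut_group n \<rho>))
              (E1_Cd_points d (2 * n div d)) (E1_Cd_perms d (2 * n div d))) \<and>
         real (num_fold_symmetric n d) =
           real d * (\<Sum>k | d dvd k \<and> k dvd 2 * n. f_term n k * of_int (moebius_mu (k div d)))"
  using fold_symmetric_iff_perm_isomorphic[OF assms] num_fold_symmetric_eq[OF assms] by blast

end
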